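(* There is a universal constant $C>0$ such that the following holds. Let $(S,\Omega)$ be a relative Sierpiński carpet, let $\zeta:S\to\mathbb R$ be a non-negative test function, and let $u:S\to\mathbb R$ be a (normalized) carpet-harmonic function. Then $$\sum_{i\in\mathbb N}M_{Q_i}(\zeta)^2\operatorname{osc}_{Q_i}(u)^2\le C\sum_{i\in\mathbb N}\operatorname{osc}_{Q_i}(\zeta)^2M_{Q_i}(|u|)^2.$$
   Context: Relative Sierpiński carpets. Let $\Omega\subset\mathbb C$ be a connected open set and $\{Q_i\}_{i\in\mathbb N}$ open Jordan regions compactly contained in $\Omega$, with pairwise disjoint closures, such that $S:=\Omega\setminus\bigcup_iQ_i$ has empty interior and is locally connected. Then $(S,\Omega)$ is a relative Sierpiński carpet with peripheral disks $Q_i$. Standing assumptions on every relative Sierpiński carpet: (i) $\mathcal H^2(S)=0$; (ii) there is $K_0\ge1$ such that for each $i$ there are concentric balls $B(x,r)\subset Q_i\subset B(x,R)$ with $R/r\le K_0$; (iii) there is $K_1>0$ such that $\mathcal H^2(B(x,r)\cap Q_i)\ge K_1r^2$ for all $i$, $x\in Q_i$, $0<r<\operatorname{diam}(Q_i)$. $\mathcal H^m$ is Hausdorff measure normalized to agree with Lebesgue measure. Notation. $\widehat{\mathbb R}=\mathbb R\cup\{\pm\infty\}$. $V\subset\subset\Omega$: $\overline V$ is compact and contained in $\Omega$. $I_V=\{i:Q_i\cap V\ne\emptyset\}$. $S^\circ$: points of $S$ on no $\partial Q_i$. A path is a continuous map from a bounded interval to $\mathbb C$ with a continuous extension to the closed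 interval (also its image); it is open if the interval is open; subpaths are restrictions to subintervals. For $g:S\to\widehat{\mathbb R}$: $M_{Q_i}(g)=\sup_{\partial Q_i}g$, $m_{Q_i}(g)=\inf_{\partial Q_i}g$, $\operatorname{osc}_{Q_i}(g)=M_{Q_i}(g)-m_{Q_i}(g)$. Moduli of a path family $\Gamma$ in $\Omega$. $\mathrm{mod}_2(\Gamma)=\inf\int\lambda^2d\mathcal H^2$ over Borel $\lambda\ge0$ with $\int_\gamma\lambda\,ds\ge1$ for all $\gamma\in\Gamma$ (with $\int_\gamma\lambda\,ds:=\infty$ if $\gamma$ is not locally rectifiable). Weak modulus $\mathrm{mod}_w(\Gamma)=\inf\sum_i\rho(Q_i)^2$ over non-negative sequences for which there is $\Gamma_0\subset\Gamma$ with $\mathrm{mod}_2(\Gamma_0)=0$ and $\sum_{i:Q_i\cap\gamma\ne\emptyset}\rho(Q_i)\ge1$ for $\gamma\in\Gamma\setminus\Gamma_0$. Strong modulus $\mathrm{mod}_s(\Gamma)$: the same infimum over sequences satisfying this inequality for all $\gamma\in\Gamma$ with $\mathcal H^1(\gamma\cap S)=0$. Sobolev spaces. $\{\rho(Q_i)\}$ is a weak (strong) upper gradient of $g:S\to\widehat{\mathbb R}$ if there is $\Gamma_0$ with $\mathrm{mod}_w(\Gamma_0)=0$ ($\mathrm{mod}_s(\Gamma_0)=0$) such that for all paths $\gamma\subset\Omega$, $\gamma\notin\Gamma_0$, and $x,y\in\gamma\cap S$: $g(x),g(y)\neq\pm\infty$ and $|g(x)-g(y)|\le\sum_{i:Q_i\cap\gamma\ne\emptyset}\rho(Q_i)$.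 $g\in\mathcal W^{1,2}_{\mathrm{loc}}(S)$ if $M_{Q_i}(g),m_{Q_i}(g)$ are finite for all $i$, $\sum_{i\in I_B}M_{Q_i}(g)^2\operatorname{diam}(Q_i)^2<\infty$ and $\sum_{i\in I_B}\operatorname{osc}_{Q_i}(g)^2<\infty$ for every ball $B\subset\subset\Omega$, and $\{\operatorname{osc}_{Q_i}(g)\}$ is an upper gradient of $g$; $g\in\mathcal W^{1,2}(S)$ if moreover the sums over all $i\in\mathbb N$ are finite. There is a weak and a strong version; the statement holds for each, with one version fixed throughout. A test function is a function $\zeta\in\mathcal W^{1,2}(S)$ that vanishes outside some open set $V\subset\subset\Omega$. Dirichlet energy: $D_V(g)=\sum_{i\in I_V}\operatorname{osc}_{Q_i}(g)^2$. $u\in\mathcal W^{1,2}_{\mathrm{loc}}(S)$ is carpet-harmonic if $D_V(u)\le D_V(u+\zeta)$ for every open $V\subset\subset\Omega$ and $\zeta\in\mathcal W^{1,2}(S)$ with $\zeta|_{S\setminus V}\equiv0$. Normalized functions. For $g\in\mathcal W^{1,2}_{\mathrm{loc}}(S)$ let $\hat g(Q_i)=M_{Q_i}(g)$. Let $\mathcal G_{\hat g}$ be the family of non-constant paths $\gamma\subset\Omega$ with: $\mathcal H^1(\gamma\cap S)=0$; for every subpath $\gamma'$ of $\gamma$ and $Q_{i_1},Q_{i_2}$ meeting $\gamma'$, $|\hat g(Q_{i_1})-\hat g(Q_{i_2})|\le\sum_{i:Q_i\cap\gamma'\neq\emptyset}\operatorname{osc}_{Q_i}(g)$; $\sum_{i:Q_i\cap\gamma'\ne\emptyset}\operatorname{osc}_{Q_i}(g)<\infty$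 for subpaths $\gamma'\subset\subset\Omega$; and, if $\sum_{i\in\mathbb N}\operatorname{osc}_{Q_i}(g)^2<\infty$, also $\sum_{i:Q_i\cap\gamma\ne\emptyset}\operatorname{osc}_{Q_i}(g)<\infty$. A point $x\in S$ is accessible by $\gamma_0$ if $x\in\gamma_0\cap S^\circ$ (put $\gamma=\gamma_0$), or there is an open subpath $\gamma$ of $\gamma_0$ with $x\in\overline\gamma\setminus\gamma$ and $\gamma\cap Q_{i_0}=\emptyset$ whenever $x\in\partial Q_{i_0}$. The normalized version $\tilde g$ of $g$ is: $\tilde g(x)=\liminf_{Q_i\to x,\,Q_i\cap\gamma\ne\emptyset}\hat g(Q_i)$ if $x$ is accessible by a path $\gamma_0\in\mathcal G_{\hat g}$, where $\gamma=\gamma_0$ if $x\in\gamma_0\cap S^\circ$, and otherwise $\gamma$ is an open subpath of $\gamma_0$ with $x\in\overline\gamma\setminus\gamma$ and $\gamma\cap Q_{i_0}=\emptyset$ whenever $x\in\partial Q_{i_0}$ (the value is independent of $\gamma$); for non-accessible $x\in\partial Q_{i_0}$, $\tilde g(x)=\liminf\tilde g(y)$ as $y\to x$ through accessible $y\in\partial Q_{i_0}$; for all other $x$, $\tilde g(x)=\liminf\tilde g(y)$ as $y\to x$ through accessible $y$. A function is normalized if it equals the normalized version of some function in the Sobolev space. Standing convention: carpet-harmonic functions are normalized. *)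

theory Defs
  imports "HOL-Analysis.Analysis"
begin

section \<open>Hausdorff measure\<close>

text \<open>
  Since \<open>unit_ball_vol m\<close> is the volume of the unit ball in dimension \<open>m\<close>, a ball of diameter
  \<open>d\<close> is given the weight \<open>unit_ball_vol m * (d / 2) ^ m\<close>; this is the normalization for which
  the \<open>m\<close>-dimensional measure agrees with Lebesgue measure in dimension \<open>m\<close>.
  The definition is meant for \<open>m > 0\<close> (the empty set gets weight \<open>1\<close> when \<open>m = 0\<close>).
\<close>

definition hausdorff_pre :: "nat \<Rightarrow> real \<Rightarrow> 'a::metric_space set \<Rightarrow> ennreal" where
  "hausdorff_pre m \<delta> A =
     (INF E \<in> {E :: nat \<Rightarrow> 'a set. A \<subseteq> (\<Union>n. E n) \<and> (\<forall>n. bounded (E n) \<and> diameter (E n) \<le> \<delta>)}.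
        \<Sum>n. ennreal (unit_ball_vol (real m) * (diameter (E n) / 2) ^ m))"

definition hausdorff_outer :: "nat \<Rightarrow> 'a::metric_space set \<Rightarrow> ennreal" where
  "hausdorff_outer m A = (SUP \<delta>\<in>{0<..}. hausdorff_pre m \<delta> A)"

definition hausdorff :: "nat \<Rightarrow> 'a::metric_space measure" where
  "hausdorff m = measure_of UNIV (sets borel) (hausdorff_outer m)"

text \<open>
  The outer measure is countably additive on the Borel sets (Caratheodory's criterion), so
  \<open>hausdorff m\<close> is the genuine Borel measure; see \<open>emeasure_hausdorff\<close>.
\<close>

lemma hausdorff_pre_mono: "A \<subseteq> B \<Longrightarrow> hausdorff_pre m \<delta> A \<le> hausdorff_pre m \<delta> B"
  unfolding hausdorff_pre_def by (rule INF_superset_mono) auto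

lemma hausdorff_pre_antimono: "\<delta> \<le> \<delta>' \<Longrightarrow> hausdorff_pre m \<delta>' A \<le> hausdorff_pre m \<delta> A"
  unfolding hausdorff_pre_def by (rule INF_superset_mono) (auto intro: order_trans)

lemma hausdorff_outer_mono: "A \<subseteq> B \<Longrightarrow> hausdorff_outer m A \<le> hausdorff_outer m B"
  unfolding hausdorff_outer_def by (intro SUP_mono) (auto intro: hausdorff_pre_mono)

lemma hausdorff_pre_empty: "0 < m \<Longrightarrow> 0 \<le> \<delta> \<Longrightarrow> hausdorff_pre m \<delta> {} = 0"
proof -
  assume m: "0 < m" and d: "0 \<le> \<delta>"
  have "hausdorff_pre m \<delta> ({} :: 'a set) \<le> (\<Sum>n. ennreal (unit_ball_vol (real m) * (diameter ((\<lambda>n. {} :: 'a set) (n::nat)) / 2) ^ m))"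
    unfolding hausdorff_pre_def by (rule INF_lower) (use d in auto)
  then show ?thesis using m by (simp add: zero_power)
qed

lemma hausdorff_outer_empty: "0 < m \<Longrightarrow> hausdorff_outer m {} = 0"
  by (auto simp: hausdorff_outer_def hausdorff_pre_empty)

lemma hausdorff_pre_UN_le:
  fixes A :: "nat \<Rightarrow> 'a::metric_space set"
  shows "hausdorff_pre m \<delta> (\<Union>k. A k) \<le> (\<Sum>k. hausdorff_pre m \<delta> (A k))"
proof (rule ennreal_le_epsilon)
  fix e :: real assume fin: "(\<Sum>k. hausdorff_pre m \<delta> (A k)) < top" and e: "0 < e"
  let ?w = "\<lambda>X :: 'a set. ennreal (unit_ball_vol (real m) * (diameter X / 2) ^ m)"
  have "\<exists>E. A k \<subseteq> (\<Union>n. E n) \<and> (\<forall>n. bounded (E n) \<and> diameter (E n) \<le> \<delta>) \<and>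
            (\<Sum>n. ?w (E n)) < hausdorff_pre m \<delta> (A k) + ennreal (e * (1/2) ^ Suc k)" for k
  proof -
    have "hausdorff_pre m \<delta> (A k) < top"
      using fin ennreal_suminf_lessD by blast
    then have "hausdorff_pre m \<delta> (A k) < hausdorff_pre m \<delta> (A k) + ennreal (e * (1/2) ^ Suc k)"
      using e by (auto simp: ennreal_zero_less_mult_iff less_top[symmetric] ennreal_add_left_cancel_less[of _ 0, simplified])
    then show ?thesis
      by (subst (asm) (1) hausdorff_pre_def) (auto simp: INF_less_iff)
  qed
  then obtain E where E: "\<And>k. A k \<subseteq> (\<Union>n. E k n)" "\<And>k n. bounded (E k n) \<and> diameter (E k n) \<le> \<delta>"
      "\<And>k. (\<Sum>n. ?w (E k n)) < hausdorff_pre m \<delta> (A k) + ennreal (e * (1/2) ^ Suc k)"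
    by metis
  let ?F = "\<lambda>n. E (fst (prod_decode n)) (snd (prod_decode n))"
  have "hausdorff_pre m \<delta> (\<Union>k. A k) \<le> (\<Sum>n. ?w (?F n))"
    unfolding hausdorff_pre_def
  proof (rule INF_lower, safe)
    fix x k assume "x \<in> A k"
    then obtain n where "x \<in> E k n" using E(1) by blast
    then have "x \<in> ?F (prod_encode (k, n))" by simp
    then show "x \<in> (\<Union>n. ?F n)" by blast
  qed (use E(2) in auto)
  also have "\<dots> = (\<Sum>k. \<Sum>n. ?w (E k n))"
    using suminf_ennreal_2dimen[where f = "\<lambda>(k, n). ?w (E k n)" and g = "\<lambda>k. \<Sum>n. ?w (E k n)"]
    by (simp add: case_prod_unfold comp_def)
  also have "\<dots> \<le> (\<Sum>k. hausdorff_pre m \<delta> (A k) + ennreal (e * (1/2) ^ Suc k))"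
    by (intro suminf_le less_imp_le[OF E(3)]) auto
  also have "\<dots> = (\<Sum>k. hausdorff_pre m \<delta> (A k)) + (\<Sum>k. ennreal (e * (1/2) ^ Suc k))"
    by (intro suminf_add[symmetric]) auto
  also have "(\<Sum>k. ennreal (e * (1/2) ^ Suc k)) = ennreal e"
  proof (rule suminf_ennreal_eq)
    show "(\<lambda>k. e * (1/2) ^ Suc k) sums e"
      using sums_mult[OF power_half_series, of e] by simp
  qed (use e in auto)
  finally show "hausdorff_pre m \<delta> (\<Union>k. A k) \<le> (\<Sum>k. hausdorff_pre m \<delta> (A k)) + ennreal e" .
qed

lemma hausdorff_outer_UN_le:
  "hausdorff_outer m (\<Union>k. A k) \<le> (\<Sum>k. hausdorff_outer m (A (k::nat)))"
  unfolding hausdorff_outer_def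
  by (intro SUP_least order_trans[OF hausdorff_pre_UN_le] suminf_le SUP_upper) auto

lemma outer_measure_hausdorff: "0 < m \<Longrightarrow> outer_measure_space UNIV (hausdorff_outer m)"
  by (auto simp: outer_measure_space_def positive_def increasing_def countably_subadditive_def
      hausdorff_outer_empty hausdorff_outer_mono hausdorff_outer_UN_le)

lemma hausdorff_outer_Un_le:
  assumes "0 < m"
  shows "hausdorff_outer m (A \<union> B) \<le> hausdorff_outer m A + hausdorff_outer m B"
  using hausdorff_outer_UN_le[of m "binaryset A B"] suminf_binaryset_eq[of "hausdorff_outer m"]
    hausdorff_outer_empty[OF assms] UN_binaryset_eq[of A B] by metis

lemma hausdorff_pre_Un:
  assumes m: "0 < m" and sep: "\<And>x y. x \<in> A \<Longrightarrow> y \<in> B \<Longrightarrow> \<delta> < dist x y" and d: "0 < \<delta>"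
  shows "hausdorff_pre m \<delta> A + hausdorff_pre m \<delta> B \<le> hausdorff_pre m \<delta> (A \<union> B)"
  unfolding hausdorff_pre_def[of _ _ "A \<union> B"]
proof (rule INF_greatest, clarify)
  fix E :: "nat \<Rightarrow> 'a set"
  assume cov: "A \<union> B \<subseteq> (\<Union>n. E n)" and E: "\<forall>n. bounded (E n) \<and> diameter (E n) \<le> \<delta>"
  let ?w = "\<lambda>X :: 'a set. ennreal (unit_ball_vol (real m) * (diameter X / 2) ^ m)"
  define F where "F = (\<lambda>n. if E n \<inter> A = {} then {} else E n)"
  define G where "G = (\<lambda>n. if E n \<inter> B = {} then {} else E n)"
  have w0: "?w {} = 0" using m by (simp add: zero_power)
  have le: "?w (F n) + ?w (G n) \<le> ?w (E n)" for n
  proof -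
    have "E n \<inter> A = {} \<or> E n \<inter> B = {}"
    proof (rule ccontr)
      assume "\<not> ?thesis"
      then obtain x y where "x \<in> E n" "x \<in> A" "y \<in> E n" "y \<in> B" by blast
      then show False
        using sep[of x y] E[rule_format, of n] diameter_bounded_bound[of "E n" x y] by linarith
    qed
    then consider "F n = {}" "G n = E n \<or> G n = {}" | "G n = {}" "F n = E n \<or> F n = {}"
      by (auto simp: F_def G_def)
    then show ?thesis
      using w0 by cases (metis add_0 add_0_right order_refl zero_le)+
  qed
  have "hausdorff_pre m \<delta> A \<le> (\<Sum>n. ?w (F n))"
    unfolding hausdorff_pre_def
    by (rule INF_lower) (use cov E d in \<open>auto simp: F_def disjoint_iff split: if_splits; blast\<close>)
  moreover have "hausdorff_pre m \<delta> B \<le> (\<Sum>n. ?w (G n))"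
    unfolding hausdorff_pre_def
    by (rule INF_lower) (use cov E d in \<open>auto simp: G_def disjoint_iff split: if_splits; blast\<close>)
  ultimately have "hausdorff_pre m \<delta> A + hausdorff_pre m \<delta> B \<le> (\<Sum>n. ?w (F n)) + (\<Sum>n. ?w (G n))"
    by (rule add_mono)
  also have "\<dots> = (\<Sum>n. ?w (F n) + ?w (G n))" by (intro suminf_add) auto
  also have "\<dots> \<le> (\<Sum>n. ?w (E n))" by (intro suminf_le le) auto
  finally show "hausdorff_pre m \<delta> A + hausdorff_pre m \<delta> B \<le> (\<Sum>n. ?w (E n))" .
qed

lemma hausdorff_outer_Un:
  assumes m: "0 < m" and d: "0 < d" and sep: "\<And>x y. x \<in> A \<Longrightarrow> y \<in> B \<Longrightarrow> d \<le> dist x y"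
  shows "hausdorff_outer m (A \<union> B) = hausdorff_outer m A + hausdorff_outer m B"
proof (rule antisym[OF hausdorff_outer_Un_le[OF m]])
  let ?H = "hausdorff_outer m (A \<union> B)"
  have step: "hausdorff_pre m a A + hausdorff_pre m b B \<le> ?H" if "0 < a" "0 < b" for a b
  proof -
    define c where "c = min (min a b) (d / 2)"
    have c: "0 < c" "c \<le> a" "c \<le> b" "c < d" using that d by (auto simp: c_def)
    have "hausdorff_pre m a A + hausdorff_pre m b B \<le> hausdorff_pre m c A + hausdorff_pre m c B"
      using c by (intro add_mono hausdorff_pre_antimono)
    also have "\<dots> \<le> hausdorff_pre m c (A \<union> B)"
      using c sep by (intro hausdorff_pre_Un[OF m]) (auto intro: less_le_trans)
    also have "\<dots> \<le> ?H" unfolding hausdorff_outer_def using c by (intro SUP_upper) auto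
    finally show ?thesis .
  qed
  have "hausdorff_outer m A + hausdorff_outer m B =
      (SUP a\<in>{0<..}. SUP b\<in>{0<..}. hausdorff_pre m a A + hausdorff_pre m b B)"
    unfolding hausdorff_outer_def
    by (subst ennreal_SUP_add_left[symmetric], simp,
        intro SUP_cong refl, subst ennreal_SUP_add_right, simp, simp)
  also have "\<dots> \<le> ?H" by (intro SUP_least) (auto intro: step)
  finally show "hausdorff_outer m A + hausdorff_outer m B \<le> ?H" .
qed

lemma closed_hausdorff_caratheodory:
  fixes C :: "'a::metric_space set"
  assumes m: "0 < m" and C: "closed C" "C \<noteq> {}"
  shows "hausdorff_outer m (X \<inter> C) + hausdorff_outer m (X - C) \<le> hausdorff_outer m X"
proof (cases "hausdorff_outer m X = top")
  case False
  let ?h = "hausdorff_outer m"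
  have fin: "?h Y < top" if "Y \<subseteq> X" for Y
    using hausdorff_outer_mono[OF that, of m] False by (simp add: le_less_trans top.not_eq_extremum)
  define A where "A n = {x \<in> X - C. 1 / real (Suc n) \<le> infdist x C}" for n
  define R where "R k = A (Suc k) - A k" for k
  have mono: "A i \<subseteq> A j" if "i \<le> j" for i j
  proof -
    have "1 / real (Suc j) \<le> 1 / real (Suc i)" using that by (simp add: field_simps)
    then show ?thesis unfolding A_def by auto
  qed
  have infd: "infdist x C \<le> dist x y + infdist y C" for x y
    using infdist_triangle[of x C y] by simp
  have sepA: "1 / real (Suc n) \<le> dist x y" if "x \<in> X \<inter> C" "y \<in> A n" for n x y
    using that infdist_le[of x C y] by (auto simp: A_def dist_commute)
  have sepR: "\<exists>d>0. \<forall>x\<in>A n. \<forall>y\<in>R (Suc n). d \<le> dist x y" for n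
  proof (intro exI conjI ballI)
    show "0 < 1 / real (Suc n) - 1 / real (Suc (Suc n))"
      by (simp add: frac_less2)
    fix x y assume "x \<in> A n" "y \<in> R (Suc n)"
    then show "1 / real (Suc n) - 1 / real (Suc (Suc n)) \<le> dist x y"
      using infd[of x y] by (auto simp: A_def R_def not_le)
  qed
  have add: "?h (A n \<union> R (Suc n)) = ?h (A n) + ?h (R (Suc n))" for n
    using sepR[of n] by (auto intro: hausdorff_outer_Un[OF m])
  have even: "(\<Sum>k<n. ?h (R (2 * k + 1))) \<le> ?h (A (2 * n))" for n
  proof (induction n)
    case (Suc n)
    have "(\<Sum>k<Suc n. ?h (R (2 * k + 1))) \<le> ?h (A (2 * n)) + ?h (R (Suc (2 * n)))"
      using Suc by (simp add: add_right_mono)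
    also have "\<dots> = ?h (A (2 * n) \<union> R (Suc (2 * n)))" by (simp add: add)
    also have "\<dots> \<le> ?h (A (2 * Suc n))"
      using mono[of "2 * n" "2 * Suc n"] by (intro hausdorff_outer_mono) (auto simp: R_def)
    finally show ?case .
  qed auto
  have odd: "(\<Sum>k<n. ?h (R (2 * k + 2))) \<le> ?h (A (2 * n + 1))" for n
  proof (induction n)
    case (Suc n)
    have "(\<Sum>k<Suc n. ?h (R (2 * k + 2))) \<le> ?h (A (2 * n + 1)) + ?h (R (Suc (2 * n + 1)))"
      using Suc by (simp add: add_right_mono)
    also have "\<dots> = ?h (A (2 * n + 1) \<union> R (Suc (2 * n + 1)))" by (rule add[symmetric])
    also have "\<dots> \<le> ?h (A (2 * Suc n + 1))"
      using mono[of "2 * n + 1" "2 * Suc n + 1"] by (intro hausdorff_outer_mono) (auto simp: R_def)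
    finally show ?case .
  qed auto
  have AX: "A n \<subseteq> X" for n by (auto simp: A_def)
  have bound: "(\<Sum>k<n. ?h (R (Suc k))) \<le> ?h X + ?h X" for n
  proof -
    have "(\<Sum>k<n. ?h (R (Suc k))) \<le> (\<Sum>k<2 * n. ?h (R (Suc k)))"
      by (intro sum_mono2) auto
    also have "\<dots> = (\<Sum>k<n. ?h (R (2 * k + 1))) + (\<Sum>k<n. ?h (R (2 * k + 2)))"
      by (induction n) (auto simp: algebra_simps)
    also have "\<dots> \<le> ?h X + ?h X"
      by (intro add_mono order_trans[OF even] order_trans[OF odd] hausdorff_outer_mono AX)
    finally show ?thesis .
  qed
  have sumfin: "(\<Sum>k. ?h (R (Suc k))) < top"
  proof -
    have "(\<Sum>k. ?h (R (Suc k))) \<le> ?h X + ?h X"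
      by (intro suminf_le_const bound) auto
    also have "\<dots> < top" using fin[of X] by simp
    finally show ?thesis .
  qed
  have cover: "X - C \<subseteq> A n \<union> (\<Union>k. R (k + n))" for n
  proof
    fix x assume x: "x \<in> X - C"
    then have "0 < infdist x C" using C infdist_pos_not_in_closed by blast
    then obtain j where "1 / real (Suc j) < infdist x C"
      using nat_approx_posE by blast
    then have ex: "x \<in> A j" using x by (auto simp: A_def)
    show "x \<in> A n \<union> (\<Union>k. R (k + n))"
    proof (cases "x \<in> A n")
      case xn: False
      define p where "p = (LEAST j. x \<in> A j)"
      have p: "x \<in> A p" using ex unfolding p_def by (rule LeastI)
      have "n < p" using xn p mono[of p n] by (meson not_le subsetD)
      then obtain q where q: "p = Suc q" "n \<le> q" by (cases p) auto
      have "x \<notin> A q" using q unfolding p_def by (metis lessI not_less_Least)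
      then have "x \<in> R ((q - n) + n)" using p q by (auto simp: R_def)
      then show ?thesis by blast
    qed auto
  qed
  have key: "?h (X \<inter> C) + ?h (X - C) \<le> ?h X + (\<Sum>k. ?h (R (k + Suc n)))" for n
  proof -
    have "?h (X - C) \<le> ?h (A (Suc n)) + (\<Sum>k. ?h (R (k + Suc n)))"
      by (intro order_trans[OF hausdorff_outer_mono[OF cover[of "Suc n"]]]
          order_trans[OF hausdorff_outer_Un_le[OF m]] add_left_mono hausdorff_outer_UN_le)
    then have "?h (X \<inter> C) + ?h (X - C) \<le> (?h (X \<inter> C) + ?h (A (Suc n))) + (\<Sum>k. ?h (R (k + Suc n)))"
      by (metis add.assoc add_left_mono)
    also have "?h (X \<inter> C) + ?h (A (Suc n)) = ?h ((X \<inter> C) \<union> A (Suc n))"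
      by (rule hausdorff_outer_Un[OF m _ sepA, symmetric]) auto
    also have "\<dots> \<le> ?h X" using AX by (intro hausdorff_outer_mono) auto
    finally show ?thesis by (simp add: add_right_mono)
  qed
  have "(\<lambda>n. \<Sum>k. ?h (R (Suc (k + n)))) \<longlonglongrightarrow> 0"
  proof -
    let ?s = "\<lambda>n. \<Sum>k<n. ?h (R (Suc k))"
    have "(\<lambda>n. (\<Sum>k. ?h (R (Suc k))) - ?s n) \<longlonglongrightarrow> (\<Sum>k. ?h (R (Suc k))) - (\<Sum>k. ?h (R (Suc k)))"
      using sumfin by (intro tendsto_diff_ennreal tendsto_const summable_LIMSEQ) auto
    moreover have "(\<Sum>k. ?h (R (Suc k))) - ?s n = (\<Sum>k. ?h (R (Suc (k + n))))" for n
    proof -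
      have "?s n \<noteq> top"
      proof -
        have RX: "R (Suc k) \<subseteq> X" for k using AX by (auto simp: R_def)
        have "?h (R (Suc k)) \<noteq> top" for k using fin[OF RX[of k]] by simp
        then show ?thesis by simp
      qed
      moreover have "(\<Sum>k. ?h (R (Suc k))) = (\<Sum>k. ?h (R (Suc (k + n)))) + ?s n"
        by (rule suminf_offset) simp
      ultimately show ?thesis by simp
    qed
    ultimately show ?thesis using sumfin by simp
  qed
  then have "(\<lambda>n. ?h X + (\<Sum>k. ?h (R (k + Suc n)))) \<longlonglongrightarrow> ?h X + 0"
    by (intro tendsto_add) auto
  then show ?thesis
    using key by (intro LIMSEQ_le_const[of _ "?h X"]) auto
qed auto

lemma measure_space_hausdorff:
  assumes m: "0 < m"
  shows "measure_space UNIV (sets (borel :: 'a::metric_space measure)) (hausdorff_outer m)"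
proof -
  interpret sigma_algebra "UNIV :: 'a set" UNIV
    using sigma_algebra_Pow[of "UNIV :: 'a set"] by simp
  let ?L = "lambda_system (UNIV :: 'a set) UNIV (hausdorff_outer m)"
  have L: "measure_space UNIV ?L (hausdorff_outer m)"
    by (rule caratheodory_lemma[OF outer_measure_hausdorff[OF m]])
  have "C \<in> ?L" if "closed C" for C :: "'a set"
  proof (cases "C = {}")
    case True
    then show ?thesis by (simp add: lambda_system_def hausdorff_outer_empty[OF m])
  next
    case False
    have "hausdorff_outer m (C \<inter> X) + hausdorff_outer m ((UNIV - C) \<inter> X) = hausdorff_outer m X" for X
    proof (rule antisym)
      show "hausdorff_outer m (C \<inter> X) + hausdorff_outer m ((UNIV - C) \<inter> X) \<le> hausdorff_outer m X"
        using closed_hausdorff_caratheodory[OF m that False, of X]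
        by (simp add: Int_commute Diff_eq)
      have "X = (C \<inter> X) \<union> ((UNIV - C) \<inter> X)" by auto
      then show "hausdorff_outer m X \<le> hausdorff_outer m (C \<inter> X) + hausdorff_outer m ((UNIV - C) \<inter> X)"
        using hausdorff_outer_Un_le[OF m] by metis
    qed
    then show ?thesis by (auto simp: lambda_system_def)
  qed
  then have sub: "sets borel \<subseteq> ?L"
  proof -
    have "sigma_sets UNIV (Collect closed) \<subseteq> ?L"
      using L \<open>\<And>C. closed C \<Longrightarrow> C \<in> ?L\<close>
      by (intro sigma_algebra.sigma_sets_subset) (auto simp: measure_space_def)
    then show ?thesis by (simp add: borel_eq_closed)
  qed
  show ?thesis
    using L sub sets.sigma_algebra_axioms[of "borel :: 'a measure"]
    by (auto simp: measure_space_def positive_def countably_additive_def)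
qed

lemma
  shows space_hausdorff [simp]: "space (hausdorff m) = UNIV"
    and sets_hausdorff [simp, measurable_cong]: "sets (hausdorff m) = sets borel"
  using sets.sigma_sets_eq[of borel] by (auto simp: hausdorff_def)

lemma emeasure_hausdorff:
  assumes "0 < m" and "A \<in> sets borel"
  shows "emeasure (hausdorff m) A = hausdorff_outer m A"
  using measure_space_hausdorff[OF assms(1), where ?'a = 'a] assms(2)
  unfolding hausdorff_def
  by (intro emeasure_measure_of_sigma) (auto simp: measure_space_def)


section \<open>Paths, length, line integrals\<close>

text \<open>
  A path is a pair of its parameter interval and a map of which only the values on that interval
  are relevant. Two pairs that agree on the common interval stand for the same path; no notion
  below distinguishes them.
\<close>

type_synonym cpath = "real set \<times> (real \<Rightarrow> complex)"

definition is_cpath :: "cpath \<Rightarrow> bool" where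
  "is_cpath \<gamma> \<longleftrightarrow>
     is_interval (fst \<gamma>) \<and> bounded (fst \<gamma>) \<and> fst \<gamma> \<noteq> {} \<and>
     (\<exists>F. continuous_on (closure (fst \<gamma>)) F \<and> (\<forall>t\<in>fst \<gamma>. F t = snd \<gamma> t))"

definition path_trace :: "cpath \<Rightarrow> complex set" where
  "path_trace \<gamma> = snd \<gamma> ` fst \<gamma>"

definition paths_in :: "complex set \<Rightarrow> cpath set" where
  "paths_in \<Omega> = {\<gamma>. is_cpath \<gamma> \<and> path_trace \<gamma> \<subseteq> \<Omega>}"

definition subpath_of :: "cpath \<Rightarrow> cpath \<Rightarrow> bool" where
  "subpath_of \<gamma>' \<gamma> \<longleftrightarrow>
     is_interval (fst \<gamma>') \<and> fst \<gamma>' \<noteq> {} \<and> fst \<gamma>' \<subseteq> fst \<gamma> \<and> snd \<gamma>' = snd \<gamma>"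

definition arc_length :: "(real \<Rightarrow> complex) \<Rightarrow> real \<Rightarrow> real \<Rightarrow> ennreal" where
  "arc_length f a b =
     (SUP ts \<in> {ts. sorted ts \<and> set ts \<subseteq> {a..b}}.
        \<Sum>k<length ts - 1. ennreal (dist (f (ts ! k)) (f (ts ! Suc k))))"

definition locally_rectifiable :: "cpath \<Rightarrow> bool" where
  "locally_rectifiable \<gamma> \<longleftrightarrow>
     (\<forall>a b. a \<le> b \<and> {a..b} \<subseteq> fst \<gamma> \<longrightarrow> arc_length (snd \<gamma>) a b < \<infinity>)"

text \<open>
  The arc length parametrization of \<open>f\<close> on \<open>{a..b}\<close>. If \<open>f\<close> is continuous and rectifiable there
  and \<open>0 \<le> s \<le> arc_length f a b\<close>, then a parameter as required exists, and \<open>f\<close> takes the same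
  value at all of them.
\<close>

definition arc_param :: "(real \<Rightarrow> complex) \<Rightarrow> real \<Rightarrow> real \<Rightarrow> real \<Rightarrow> complex" where
  "arc_param f a b s = f (SOME t. t \<in> {a..b} \<and> arc_length f a t = ennreal s)"

definition line_integral :: "(complex \<Rightarrow> ennreal) \<Rightarrow> cpath \<Rightarrow> ennreal" where
  "line_integral h \<gamma> =
     (if locally_rectifiable \<gamma>
      then SUP (a, b) \<in> {(a, b). a \<le> b \<and> {a..b} \<subseteq> fst \<gamma>}.
             \<integral>\<^sup>+ s \<in> {0..enn2real (arc_length (snd \<gamma>) a b)}. h (arc_param (snd \<gamma>) a b s) \<partial>lborel
      else \<infinity>)"


section \<open>Relative Sierpinski carpets\<close>

definition compactly_in :: "complex set \<Rightarrow> complex set \<Rightarrow> bool" where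
  "compactly_in V \<Omega> \<longleftrightarrow> compact (closure V) \<and> closure V \<subseteq> \<Omega>"

definition open_jordan_region :: "complex set \<Rightarrow> bool" where
  "open_jordan_region U \<longleftrightarrow>
     (\<exists>c. simple_path c \<and> pathfinish c = pathstart c \<and> U = inside (path_image c))"

definition carpet :: "complex set \<Rightarrow> (nat \<Rightarrow> complex set) \<Rightarrow> complex set" where
  "carpet \<Omega> Q = \<Omega> - (\<Union>i. Q i)"

definition relative_carpet :: "complex set \<Rightarrow> (nat \<Rightarrow> complex set) \<Rightarrow> bool" where
  "relative_carpet \<Omega> Q \<longleftrightarrow>
     open \<Omega> \<and> connected \<Omega> \<and>
     (\<forall>i. open_jordan_region (Q i) \<and> compactly_in (Q i) \<Omega>) \<and>
     disjoint_family (\<lambda>i. closure (Q i)) \<and>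
     interior (carpet \<Omega> Q) = {} \<and>
     locally connected (carpet \<Omega> Q) \<and>
     hausdorff_outer 2 (carpet \<Omega> Q) = 0 \<and>
     (\<exists>K0\<ge>1. \<forall>i. \<exists>x r R. 0 < r \<and> ball x r \<subseteq> Q i \<and> Q i \<subseteq> ball x R \<and> R / r \<le> K0) \<and>
     (\<exists>K1>0. \<forall>i. \<forall>x\<in>Q i. \<forall>r. 0 < r \<and> r < diameter (Q i) \<longrightarrow>
        hausdorff_outer 2 (ball x r \<inter> Q i) \<ge> ennreal (K1 * r\<^sup>2))"

text \<open>The indices of the peripheral disks meeting a set (the set \<open>I_V\<close>).\<close>

definition meeting :: "(nat \<Rightarrow> complex set) \<Rightarrow> complex set \<Rightarrow> nat set" where
  "meeting Q V = {i. Q i \<inter> V \<noteq> {}}"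

definition carpet_inner :: "complex set \<Rightarrow> (nat \<Rightarrow> complex set) \<Rightarrow> complex set" where
  "carpet_inner \<Omega> Q = carpet \<Omega> Q - (\<Union>i. frontier (Q i))"


section \<open>Moduli\<close>

definition mod_2 :: "cpath set \<Rightarrow> ennreal" where
  "mod_2 \<Gamma> =
     (INF h \<in> {h \<in> borel_measurable borel. \<forall>\<gamma>\<in>\<Gamma>. line_integral h \<gamma> \<ge> 1}.
        \<integral>\<^sup>+ z. (h z)\<^sup>2 \<partial>hausdorff 2)"

definition mod_weak :: "(nat \<Rightarrow> complex set) \<Rightarrow> cpath set \<Rightarrow> ennreal" where
  "mod_weak Q \<Gamma> =
     (INF \<rho> \<in> {\<rho> :: nat \<Rightarrow> real. (\<forall>i. \<rho> i \<ge> 0) \<and>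
                 (\<exists>\<Gamma>0\<subseteq>\<Gamma>. mod_2 \<Gamma>0 = 0 \<and>
                    (\<forall>\<gamma>\<in>\<Gamma> - \<Gamma>0. (\<Sum>\<^sub>\<infinity>i\<in>meeting Q (path_trace \<gamma>). ennreal (\<rho> i)) \<ge> 1))}.
        \<Sum>\<^sub>\<infinity>i. ennreal ((\<rho> i)\<^sup>2))"

definition mod_strong :: "complex set \<Rightarrow> (nat \<Rightarrow> complex set) \<Rightarrow> cpath set \<Rightarrow> ennreal" where
  "mod_strong \<Omega> Q \<Gamma> =
     (INF \<rho> \<in> {\<rho> :: nat \<Rightarrow> real. (\<forall>i. \<rho> i \<ge> 0) \<and>
                 (\<forall>\<gamma>\<in>\<Gamma>. hausdorff_outer 1 (path_trace \<gamma> \<inter> carpet \<Omega> Q) = 0 \<longrightarrow>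
                    (\<Sum>\<^sub>\<infinity>i\<in>meeting Q (path_trace \<gamma>). ennreal (\<rho> i)) \<ge> 1)}.
        \<Sum>\<^sub>\<infinity>i. ennreal ((\<rho> i)\<^sup>2))"

datatype version = Weak | Strong

fun carpet_mod :: "version \<Rightarrow> complex set \<Rightarrow> (nat \<Rightarrow> complex set) \<Rightarrow> cpath set \<Rightarrow> ennreal" where
  "carpet_mod Weak \<Omega> Q \<Gamma> = mod_weak Q \<Gamma>"
| "carpet_mod Strong \<Omega> Q \<Gamma> = mod_strong \<Omega> Q \<Gamma>"


section \<open>Sobolev spaces and carpet-harmonic functions\<close>

text \<open>
  A function on the carpet is represented by a total function on the plane; only its values on the
  carpet (which contains the boundaries of all peripheral disks) are ever used.
\<close>

definition M_Q :: "(nat \<Rightarrow> complex set) \<Rightarrow> (complex \<Rightarrow> ereal) \<Rightarrow> nat \<Rightarrow> ereal" where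
  "M_Q Q g i = (SUP x\<in>frontier (Q i). g x)"

definition m_Q :: "(nat \<Rightarrow> complex set) \<Rightarrow> (complex \<Rightarrow> ereal) \<Rightarrow> nat \<Rightarrow> ereal" where
  "m_Q Q g i = (INF x\<in>frontier (Q i). g x)"

definition osc_Q :: "(nat \<Rightarrow> complex set) \<Rightarrow> (complex \<Rightarrow> ereal) \<Rightarrow> nat \<Rightarrow> ennreal" where
  "osc_Q Q g i = e2ennreal (M_Q Q g i - m_Q Q g i)"

definition upper_gradient ::
  "version \<Rightarrow> complex set \<Rightarrow> (nat \<Rightarrow> complex set) \<Rightarrow> (nat \<Rightarrow> ennreal) \<Rightarrow> (complex \<Rightarrow> ereal) \<Rightarrow> bool" where
  "upper_gradient v \<Omega> Q \<rho> g \<longleftrightarrow>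
     (\<exists>\<Gamma>0\<subseteq>paths_in \<Omega>. carpet_mod v \<Omega> Q \<Gamma>0 = 0 \<and>
        (\<forall>\<gamma>\<in>paths_in \<Omega> - \<Gamma>0. \<forall>x\<in>path_trace \<gamma> \<inter> carpet \<Omega> Q. \<forall>y\<in>path_trace \<gamma> \<inter> carpet \<Omega> Q.
           g x \<noteq> \<infinity> \<and> g x \<noteq> -\<infinity> \<and> g y \<noteq> \<infinity> \<and> g y \<noteq> -\<infinity> \<and>
           \<bar>g x - g y\<bar> \<le> enn2ereal (\<Sum>\<^sub>\<infinity>i\<in>meeting Q (path_trace \<gamma>). \<rho> i)))"

definition sobolev_loc ::
  "version \<Rightarrow> complex set \<Rightarrow> (nat \<Rightarrow> complex set) \<Rightarrow> (complex \<Rightarrow> ereal) \<Rightarrow> bool" where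
  "sobolev_loc v \<Omega> Q g \<longleftrightarrow>
     (\<forall>i. \<bar>M_Q Q g i\<bar> \<noteq> \<infinity> \<and> \<bar>m_Q Q g i\<bar> \<noteq> \<infinity>) \<and>
     (\<forall>x r. 0 < r \<and> compactly_in (ball x r) \<Omega> \<longrightarrow>
        (\<Sum>\<^sub>\<infinity>i\<in>meeting Q (ball x r). e2ennreal ((M_Q Q g i)\<^sup>2) * ennreal ((diameter (Q i))\<^sup>2)) < \<infinity> \<and>
        (\<Sum>\<^sub>\<infinity>i\<in>meeting Q (ball x r). (osc_Q Q g i)\<^sup>2) < \<infinity>) \<and>
     upper_gradient v \<Omega> Q (osc_Q Q g) g"

definition sobolev ::
  "version \<Rightarrow> complex set \<Rightarrow> (nat \<Rightarrow> complex set) \<Rightarrow> (complex \<Rightarrow> ereal) \<Rightarrow> bool" where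
  "sobolev v \<Omega> Q g \<longleftrightarrow>
     sobolev_loc v \<Omega> Q g \<and>
     (\<Sum>\<^sub>\<infinity>i. e2ennreal ((M_Q Q g i)\<^sup>2) * ennreal ((diameter (Q i))\<^sup>2)) < \<infinity> \<and>
     (\<Sum>\<^sub>\<infinity>i. (osc_Q Q g i)\<^sup>2) < \<infinity>"

definition test_function ::
  "version \<Rightarrow> complex set \<Rightarrow> (nat \<Rightarrow> complex set) \<Rightarrow> (complex \<Rightarrow> ereal) \<Rightarrow> bool" where
  "test_function v \<Omega> Q \<zeta> \<longleftrightarrow>
     sobolev v \<Omega> Q \<zeta> \<and>
     (\<exists>V. open V \<and> compactly_in V \<Omega> \<and> (\<forall>x\<in>carpet \<Omega> Q - V. \<zeta> x = 0))"

definition dirichlet_energy ::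
  "(nat \<Rightarrow> complex set) \<Rightarrow> complex set \<Rightarrow> (complex \<Rightarrow> ereal) \<Rightarrow> ennreal" where
  "dirichlet_energy Q V g = (\<Sum>\<^sub>\<infinity>i\<in>meeting Q V. (osc_Q Q g i)\<^sup>2)"

definition carpet_harmonic ::
  "version \<Rightarrow> complex set \<Rightarrow> (nat \<Rightarrow> complex set) \<Rightarrow> (complex \<Rightarrow> ereal) \<Rightarrow> bool" where
  "carpet_harmonic v \<Omega> Q u \<longleftrightarrow>
     sobolev_loc v \<Omega> Q u \<and>
     (\<forall>V \<zeta>. open V \<and> compactly_in V \<Omega> \<and> sobolev v \<Omega> Q \<zeta> \<and> (\<forall>x\<in>carpet \<Omega> Q - V. \<zeta> x = 0) \<longrightarrow>
        dirichlet_energy Q V u \<le> dirichlet_energy Q V (\<lambda>x. u x + \<zeta> x))"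


section \<open>Normalized functions\<close>

definition good_paths ::
  "complex set \<Rightarrow> (nat \<Rightarrow> complex set) \<Rightarrow> (complex \<Rightarrow> ereal) \<Rightarrow> cpath set" where
  "good_paths \<Omega> Q g =
     {\<gamma> \<in> paths_in \<Omega>.
        \<not> snd \<gamma> constant_on fst \<gamma> \<and>
        hausdorff_outer 1 (path_trace \<gamma> \<inter> carpet \<Omega> Q) = 0 \<and>
        (\<forall>\<gamma>'. subpath_of \<gamma>' \<gamma> \<longrightarrow>
           (\<forall>i\<in>meeting Q (path_trace \<gamma>'). \<forall>j\<in>meeting Q (path_trace \<gamma>').
              \<bar>M_Q Q g i - M_Q Q g j\<bar> \<le> enn2ereal (\<Sum>\<^sub>\<infinity>k\<in>meeting Q (path_trace \<gamma>'). osc_Q Q g k)) \<and>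
           (compactly_in (path_trace \<gamma>') \<Omega> \<longrightarrow> (\<Sum>\<^sub>\<infinity>k\<in>meeting Q (path_trace \<gamma>'). osc_Q Q g k) < \<infinity>)) \<and>
        ((\<Sum>\<^sub>\<infinity>k. (osc_Q Q g k)\<^sup>2) < \<infinity> \<longrightarrow>
           (\<Sum>\<^sub>\<infinity>k\<in>meeting Q (path_trace \<gamma>). osc_Q Q g k) < \<infinity>)}"

text \<open>
  \<open>access_path \<Omega> Q g x \<gamma>\<close>: the path \<open>\<gamma>\<close> is one through which the value of the normalized version
  of \<open>g\<close> at \<open>x\<close> may be computed.
\<close>

definition access_path ::
  "complex set \<Rightarrow> (nat \<Rightarrow> complex set) \<Rightarrow> (complex \<Rightarrow> ereal) \<Rightarrow> complex \<Rightarrow> cpath \<Rightarrow> bool" where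
  "access_path \<Omega> Q g x \<gamma> \<longleftrightarrow>
     (\<exists>\<gamma>0\<in>good_paths \<Omega> Q g.
        if x \<in> path_trace \<gamma>0 \<inter> carpet_inner \<Omega> Q then \<gamma> = \<gamma>0
        else subpath_of \<gamma> \<gamma>0 \<and> open (fst \<gamma>) \<and> x \<in> closure (path_trace \<gamma>) - path_trace \<gamma> \<and>
             (\<forall>i. x \<in> frontier (Q i) \<longrightarrow> path_trace \<gamma> \<inter> Q i = {}))"

definition accessible ::
  "complex set \<Rightarrow> (nat \<Rightarrow> complex set) \<Rightarrow> (complex \<Rightarrow> ereal) \<Rightarrow> complex set" where
  "accessible \<Omega> Q g = {x \<in> carpet \<Omega> Q. \<exists>\<gamma>. access_path \<Omega> Q g x \<gamma>}"

text \<open>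
  The limit inferior of \<open>M_Q Q g i\<close> as \<open>Q i\<close> shrinks to the point \<open>x\<close>, over those disks that
  meet the path.
\<close>

definition disk_liminf ::
  "(nat \<Rightarrow> complex set) \<Rightarrow> (complex \<Rightarrow> ereal) \<Rightarrow> complex \<Rightarrow> cpath \<Rightarrow> ereal" where
  "disk_liminf Q g x \<gamma> =
     (SUP \<epsilon>\<in>{0<..}. INF i\<in>{i \<in> meeting Q (path_trace \<gamma>). Q i \<subseteq> ball x \<epsilon>}. M_Q Q g i)"

text \<open>The value does not depend on the choice of the path.\<close>

definition access_value ::
  "complex set \<Rightarrow> (nat \<Rightarrow> complex set) \<Rightarrow> (complex \<Rightarrow> ereal) \<Rightarrow> complex \<Rightarrow> ereal" where
  "access_value \<Omega> Q g x = disk_liminf Q g x (SOME \<gamma>. access_path \<Omega> Q g x \<gamma>)"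

text \<open>
  The closures of the peripheral disks being disjoint, the index of a disk with \<open>x\<close> on its
  boundary is unique.
\<close>

definition normalized_version ::
  "complex set \<Rightarrow> (nat \<Rightarrow> complex set) \<Rightarrow> (complex \<Rightarrow> ereal) \<Rightarrow> complex \<Rightarrow> ereal" where
  "normalized_version \<Omega> Q g x =
     (if x \<in> accessible \<Omega> Q g then access_value \<Omega> Q g x
      else if \<exists>i. x \<in> frontier (Q i)
      then Liminf (at x within accessible \<Omega> Q g \<inter> frontier (Q (THE i. x \<in> frontier (Q i))))
             (access_value \<Omega> Q g)
      else Liminf (at x within accessible \<Omega> Q g) (access_value \<Omega> Q g))"

definition normalized ::
  "version \<Rightarrow> complex set \<Rightarrow> (nat \<Rightarrow> complex set) \<Rightarrow> (complex \<Rightarrow> ereal) \<Rightarrow> bool" where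
  "normalized v \<Omega> Q h \<longleftrightarrow>
     (\<exists>g. sobolev_loc v \<Omega> Q g \<and> (\<forall>x\<in>carpet \<Omega> Q. h x = normalized_version \<Omega> Q g x))"

end

theory Submission
  imports Defs
begin

text \<open>
  The energy of \<open>u\<close> is compared with that of \<open>(1 - \<eta>\<^sup>2) u\<close>, where \<open>\<eta> = min \<zeta> N / N\<close>. On a peripheral
  circle, with \<open>t = sup \<eta>\<close> and \<open>k = osc \<zeta> * sup \<bar>u\<bar> / N\<close>, the oscillation of the competitor is at most
  \<open>(1 - t\<^sup>2) osc u + 6 t k\<close>, so its square is at most \<open>(1 - t\<^sup>2 / 2) (osc u)\<^sup>2 + 108 k\<^sup>2\<close>. Minimality
  of \<open>u\<close> cancels the finite sum of \<open>(osc u)\<^sup>2\<close> and leaves the inequality with \<open>min \<zeta> N\<close>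
  in place of \<open>\<zeta>\<close>, for every \<open>N\<close>.

  It has to be shown that \<open>\<eta>\<^sup>2 u\<close> lies in the Sobolev space, in particular that its own oscillations
  form an upper gradient. Along almost every path its differences are controlled by a multiple of
  \<open>osc u + osc \<zeta>\<close>, which has finite sum over the disks met by the path. Jumping over all but a small
  tail of these disks, at most once over each, replaces this bound by the oscillations themselves.
\<close>

section \<open>Sums in the extended nonnegative reals\<close>

text \<open>The factor \<open>1 - \<eta>^2\<close>, rather than \<open>1 - \<eta>\<close>, lets the
  estimate close: the cross term of the squared oscillation then carries a factor t and can be
  absorbed into \<open>t^2 (osc u)^2\<close>, the amount saved by the leading term. The truncation
  keeps \<open>\<eta>\<close> in the unit interval although \<open>\<zeta>\<close> may be unbounded
  over the carpet; t and k both carry a factor 1/N, so the height cancels from the final bound. The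
  energy of u can be cancelled because V is compactly contained. The right-hand side may be assumed
  finite, and this makes the variation an admissible test function.

  The obstacle is the upper gradient. Since u may be unbounded, the product rule controls
  \<open>\<eta>^2 u\<close> only with a factor depending on the path, whereas the Sobolev class
  demands the oscillations of the product themselves. The jumping argument is topological and turns
  any summable bound, however large its factor, into the bound by oscillations. It needs the bound
  on every segment of the path, which is why a path is discarded as soon as one of its subpaths is
  exceptional.\<close>

lemma infsum_ennreal_SUP:
  fixes f :: "'i \<Rightarrow> ennreal"
  shows "infsum f A = (SUP F\<in>{F. finite F \<and> F \<subseteq> A}. sum f F)"
  by (rule nonneg_infsum_complete) simp

lemma infsum_ennreal_mono:
  fixes f g :: "'i \<Rightarrow> ennreal"
  assumes "\<And>i. i \<in> A \<Longrightarrow> f i \<le> g i"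
  shows "infsum f A \<le> infsum g A"
  using assms by (intro infsum_mono nonneg_summable_on_complete) auto

lemma infsum_ennreal_subset:
  fixes f :: "'i \<Rightarrow> ennreal"
  assumes "A \<subseteq> B"
  shows "infsum f A \<le> infsum f B"
  using assms by (intro infsum_mono_neutral nonneg_summable_on_complete) auto

lemma infsum_ennreal_cmult:
  fixes f :: "'i \<Rightarrow> ennreal"
  shows "infsum (\<lambda>i. c * f i) A = c * infsum f A"
  unfolding infsum_ennreal_SUP sum_distrib_left[symmetric]
  by (rule SUP_mult_left_ennreal[symmetric])

lemma infsum_ennreal_add:
  fixes f g :: "'i \<Rightarrow> ennreal"
  shows "infsum (\<lambda>i. f i + g i) A = infsum f A + infsum g A"
  by (intro infsum_add nonneg_summable_on_complete) auto

lemma sum_infsum_ennreal: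
  fixes f :: "'k \<Rightarrow> 'i \<Rightarrow> ennreal"
  shows "finite K \<Longrightarrow> (\<Sum>k\<in>K. infsum (f k) A) = infsum (\<lambda>i. \<Sum>k\<in>K. f k i) A"
  by (induction K rule: finite_induct) (auto simp: infsum_ennreal_add)

lemma sum_le_infsum_ennreal:
  fixes f :: "'i \<Rightarrow> ennreal"
  assumes "finite F" "F \<subseteq> A"
  shows "sum f F \<le> infsum f A"
  unfolding infsum_ennreal_SUP using assms by (intro SUP_upper) auto

lemma infsum_ennreal_leI:
  fixes f :: "'i \<Rightarrow> ennreal"
  assumes "\<And>F. finite F \<Longrightarrow> F \<subseteq> A \<Longrightarrow> sum f F \<le> c"
  shows "infsum f A \<le> c"
  unfolding infsum_ennreal_SUP using assms by (intro SUP_least) auto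

lemma infsum_ennreal_tail:
  fixes f :: "'i \<Rightarrow> ennreal"
  assumes fin: "infsum f A < \<infinity>" and e: "0 < e"
  obtains F where "finite F" "F \<subseteq> A" "infsum f (A - F) \<le> ennreal e"
proof (cases "infsum f A = 0")
  case True
  have "infsum f (A - {}) \<le> ennreal e" using True by simp
  then show ?thesis using that[of "{}"] by simp
next
  case False
  \<comment> \<open>Strict because the total is positive and finite; subtraction in
    \<open>ennreal\<close> is truncated at 0, hence the separate case of a zero total.\<close>
  have "infsum f A - ennreal e < infsum f A"
    using False fin e
    by (intro ennreal_between) (auto simp: zero_less_iff_neq_zero)
  then obtain F where F: "finite F" "F \<subseteq> A" "infsum f A - ennreal e < sum f F"
    unfolding infsum_ennreal_SUP[of f A] less_SUP_iff by auto
  have "infsum f A = sum f F + infsum f (A - F)"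
    using infsum_Un_disjoint[of f F "A - F"] F(1,2)
    by (simp add: Un_absorb1 nonneg_summable_on_complete)
  moreover have "sum f F \<noteq> top"
    using fin sum_le_infsum_ennreal[OF F(1,2), of f] by (auto simp: top_unique)
  moreover have "infsum f A \<le> sum f F + ennreal e"
    using F(3) ennreal_minus_le_iff[of "infsum f A" "ennreal e" "sum f F"] by (simp add: add.commute less_imp_le)
  ultimately have "infsum f (A - F) \<le> ennreal e"
    by (simp add: ennreal_add_left_cancel_le)
  then show ?thesis using that F by blast
qed

text \<open>Telescoping along f 0, g 0, f 1, g 1, ..., f n, g n. The n + 1 differences over pieces
  and the n differences over jumps stay apart because they will be bounded by different
  weights.\<close>

lemma ennreal_abs_diff_chain:
  fixes f g :: "nat \<Rightarrow> real"
  shows "ennreal \<bar>f 0 - g n\<bar> \<le> (\<Sum>k\<le>n. ennreal \<bar>f k - g k\<bar>) + (\<Sum>k<n. ennreal \<bar>g k - f (Suc k)\<bar>)"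
proof (induction n)
  case (Suc n)
  have "ennreal \<bar>f 0 - g (Suc n)\<bar> \<le>
      ennreal (\<bar>f 0 - g n\<bar> + (\<bar>f (Suc n) - g (Suc n)\<bar> + \<bar>g n - f (Suc n)\<bar>))"
    by (intro ennreal_leI) linarith
  also have "\<dots> = ennreal \<bar>f 0 - g n\<bar> + (ennreal \<bar>f (Suc n) - g (Suc n)\<bar> + ennreal \<bar>g n - f (Suc n)\<bar>)"
    by (simp add: ennreal_plus)
  also have "\<dots> \<le> ((\<Sum>k\<le>n. ennreal \<bar>f k - g k\<bar>) + (\<Sum>k<n. ennreal \<bar>g k - f (Suc k)\<bar>)) +
      (ennreal \<bar>f (Suc n) - g (Suc n)\<bar> + ennreal \<bar>g n - f (Suc n)\<bar>)"
    by (intro add_mono Suc order_refl)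
  finally show ?case by (simp add: ac_simps)
qed simp

section \<open>Oscillation along a path\<close>

locale disk_path =
  fixes \<gamma> :: "real \<Rightarrow> 'a::topological_space" and I :: "real set" and Q :: "'i \<Rightarrow> 'a set"
  assumes interval: "is_interval I" and cont: "continuous_on I \<gamma>"
    and open_disk: "\<And>i. open (Q i)"
    and frontier_disjoint: "\<And>i j. frontier (Q i) \<inter> Q j = {}"
begin

section \<open>Chains of pieces and jumps\<close>

definition free :: "real \<Rightarrow> bool" where
  "free t \<longleftrightarrow> t \<in> I \<and> (\<forall>i. \<gamma> t \<notin> Q i)"

definition hit :: "real set \<Rightarrow> 'i set" where
  "hit A = {i. Q i \<inter> \<gamma> ` A \<noteq> {}}"

definition piece :: "'i set \<Rightarrow> real \<Rightarrow> real \<Rightarrow> bool" where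
  "piece J x y \<longleftrightarrow> free x \<and> free y \<and> hit (closed_segment x y) \<inter> J = {}"

text \<open>A jump ignores the path between its ends and costs only the oscillation on the boundary
  of the disk; the order of x and y is arbitrary. The condition on \<open>hit I\<close> ensures that
  this cost occurs in the sum along the path.\<close>

definition jump :: "'i \<Rightarrow> real \<Rightarrow> real \<Rightarrow> bool" where
  "jump i x y \<longleftrightarrow> i \<in> hit I \<and> x \<in> I \<and> y \<in> I \<and> \<gamma> x \<in> frontier (Q i) \<and> \<gamma> y \<in> frontier (Q i)"

text \<open>The unit in which chains are counted: a chain is a number of moves followed by one last
  piece.\<close>

definition move :: "'i set \<Rightarrow> real \<Rightarrow> real \<Rightarrow> bool" where
  "move J x y \<longleftrightarrow> (\<exists>t i. piece J x t \<and> jump i t y)"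

lemma segment_subset: "x \<in> I \<Longrightarrow> y \<in> I \<Longrightarrow> closed_segment x y \<subseteq> I"
  using interval by (simp add: closed_segment_subset is_interval_convex_1)

lemma free_frontier: "x \<in> I \<Longrightarrow> \<gamma> x \<in> frontier (Q i) \<Longrightarrow> free x"
  using frontier_disjoint by (auto simp: free_def)

lemma hit_mono: "A \<subseteq> B \<Longrightarrow> hit A \<subseteq> hit B"
  by (auto simp: hit_def)

lemma piece_commute: "piece J x y \<longleftrightarrow> piece J y x"
  by (auto simp: piece_def closed_segment_commute)

lemma piece_sub: "piece J x y \<Longrightarrow> free p \<Longrightarrow> p \<in> closed_segment x y \<Longrightarrow> piece J x p"
  unfolding piece_def using hit_mono[of "closed_segment x p" "closed_segment x y"]
  by (metis ends_in_segment(1) disjoint_iff in_mono subset_closed_segment)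

text \<open>Take the p nearest to x whose image lies in the closure of the disk. Were that image
  inside the disk, the connected image of the segment from x to p would cross the frontier, and by
  minimality the crossing would be at p itself.\<close>

lemma first_hit:
  assumes x: "free x" and y: "y \<in> I" and i: "i \<in> hit (closed_segment x y)"
  obtains p where "p \<in> closed_segment x y" "\<gamma> p \<in> frontier (Q i)" "i \<notin> hit (closed_segment x p)"
proof -
  let ?T = "{t \<in> closed_segment x y. \<gamma> t \<in> closure (Q i)}"
  have xI: "x \<in> I" using x by (simp add: free_def)
  have sub: "closed_segment x y \<subseteq> I" by (rule segment_subset[OF xI y])
  have "closed (closed_segment x y \<inter> \<gamma> -` closure (Q i))"
    using continuous_on_subset[OF cont sub] by (intro continuous_closed_preimage) auto
  also have "closed_segment x y \<inter> \<gamma> -` closure (Q i) = ?T" by auto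
  finally have "closed ?T" .
  moreover have "?T \<noteq> {}"
    using i closure_subset[of "Q i"] by (fastforce simp: hit_def)
  ultimately obtain p where p: "p \<in> ?T" "\<And>t. t \<in> ?T \<Longrightarrow> dist x p \<le> dist x t"
    using distance_attains_inf[of ?T x] by metis
  have ps: "closed_segment x p \<subseteq> closed_segment x y"
    using p(1) by (simp add: subset_closed_segment)
  have closest: "t = p" if "t \<in> closed_segment x p" "\<gamma> t \<in> closure (Q i)" for t
  proof -
    have "dist x p \<le> dist x t" using p(2) that ps by auto
    then show ?thesis using that(1)
      by (auto simp: closed_segment_eq_real_ivl dist_real_def split: if_splits)
  qed
  have fr: "\<gamma> p \<in> frontier (Q i)"
  proof (rule ccontr)
    assume "\<gamma> p \<notin> frontier (Q i)"
    then have "\<gamma> p \<in> Q i"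
      using p(1) open_disk by (auto simp: frontier_def interior_open)
    moreover have "\<gamma> x \<notin> Q i" using x by (simp add: free_def)
    moreover have "connected (\<gamma> ` closed_segment x p)"
      using continuous_on_subset[OF cont] ps sub by (intro connected_continuous_image) auto
    ultimately have "\<gamma> ` closed_segment x p \<inter> frontier (Q i) \<noteq> {}"
      by (intro connected_Int_frontier) auto
    then obtain t where "t \<in> closed_segment x p" "\<gamma> t \<in> frontier (Q i)" by auto
    with closest[of t] \<open>\<gamma> p \<notin> frontier (Q i)\<close> show False
      by (auto simp: frontier_def)
  qed
  moreover have "i \<notin> hit (closed_segment x p)"
    using closest fr frontier_disjoint[of i i] closure_subset[of "Q i"]
    by (fastforce simp: hit_def)
  ultimately show ?thesis using that p(1) by blast
qed

lemma move_step:
  assumes "(move J)\<^sup>*\<^sup>* x z" "piece J z p" "jump i p q" "(move J)\<^sup>*\<^sup>* q w"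
  shows "(move J)\<^sup>*\<^sup>* x w"
proof -
  have "move J z q" using assms(2,3) by (auto simp: move_def)
  then show ?thesis using assms(1,4) by (meson rtranclp.rtrancl_into_rtrancl rtranclp_trans)
qed

text \<open>Stop at the first contact with \<open>Q j\<close> seen from x and at the first contact
  seen from y. One jump replaces everything in between, however often the segment returns to the
  disk, and the two remaining ends avoid j as well as J.\<close>

lemma piece_refine:
  assumes "piece J x y"
  shows "\<exists>z. (move (insert j J))\<^sup>*\<^sup>* x z \<and> piece (insert j J) z y"
proof (cases "j \<in> hit (closed_segment x y)")
  case False
  then show ?thesis using assms by (auto simp: piece_def)
next
  case True
  have f: "free x" "free y" and I: "x \<in> I" "y \<in> I" using assms by (auto simp: piece_def free_def)
  obtain p where p: "p \<in> closed_segment x y" "\<gamma> p \<in> frontier (Q j)" "j \<notin> hit (closed_segment x p)"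
    using first_hit[OF f(1) I(2) True] .
  obtain q where q: "q \<in> closed_segment y x" "\<gamma> q \<in> frontier (Q j)" "j \<notin> hit (closed_segment y q)"
    using first_hit[OF f(2) I(1)] True by (metis closed_segment_commute)
  have pq: "p \<in> I" "q \<in> I" using p(1) q(1) segment_subset I by blast+
  have "piece J x p" "piece J y q"
    using assms p q pq free_frontier piece_sub piece_commute by meson+
  then have pieces: "piece (insert j J) x p" "piece (insert j J) q y"
    using p(3) q(3) by (auto simp: piece_def closed_segment_commute)
  have "jump j p q"
    using True hit_mono[OF segment_subset[OF I]] pq p q by (auto simp: jump_def)
  then have "move (insert j J) x q" using pieces by (auto simp: move_def)
  then show ?thesis using pieces by blast
qed

text \<open>When a disk is added to J, each piece of the chain is refined separately; the old jumps
  survive because their definition does not involve J.\<close>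

lemma chain_exists:
  assumes "finite J" "free a" "free b"
  shows "\<exists>z. (move J)\<^sup>*\<^sup>* a z \<and> piece J z b"
  using assms(1)
proof induction
  case empty
  have "piece {} a b" using assms by (simp add: piece_def)
  then show ?case by blast
next
  case (insert j J)
  then obtain z where z: "(move J)\<^sup>*\<^sup>* a z" "piece J z b" by blast
  from z(1) show ?case
  proof (induction rule: converse_rtranclp_induct)
    case base
    then show ?case using piece_refine[OF z(2)] .
  next
    case (step x y)
    then obtain t i where t: "piece J x t" "jump i t y" by (auto simp: move_def)
    obtain z' where "(move (insert j J))\<^sup>*\<^sup>* x z'" "piece (insert j J) z' t"
      using piece_refine[OF t(1)] by blast
    then show ?case using move_step t(2) step.IH by meson
  qed
qed

text \<open>
  Outside a finite set \<open>J\<close> carrying almost all of \<open>\<rho>\<close>, the path from \<open>a\<close> to \<open>b\<close> is replaced by a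
  chain of pieces avoiding the disks in \<open>J\<close>, joined by jumps across disks. In a chain with the
  least number of jumps no disk is jumped twice and every disk meets at most two pieces.
\<close>

lemma diff_le_sum_osc:
  fixes F :: "'a \<Rightarrow> real" and \<rho> c :: "'i \<Rightarrow> ennreal"
  assumes a: "free a" and b: "free b"
    and ug: "\<And>x y. free x \<Longrightarrow> free y \<Longrightarrow>
      ennreal \<bar>F (\<gamma> x) - F (\<gamma> y)\<bar> \<le> infsum \<rho> (hit (closed_segment x y))"
    and fin: "infsum \<rho> (hit I) < \<infinity>"
    and osc: "\<And>i x y. x \<in> frontier (Q i) \<Longrightarrow> y \<in> frontier (Q i) \<Longrightarrow> ennreal \<bar>F x - F y\<bar> \<le> c i"
  shows "ennreal \<bar>F (\<gamma> a) - F (\<gamma> b)\<bar> \<le> infsum c (hit I)"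
proof (rule ennreal_le_epsilon)
  fix e :: real assume e: "0 < e"
  \<comment> \<open>Half of e, because each disk outside J will be counted by at most two
    pieces.\<close>
  obtain J where J: "finite J" "infsum \<rho> (hit I - J) \<le> ennreal (e / 2)"
    using infsum_ennreal_tail[OF fin, of "e / 2"] e by auto
  define P where "P m \<longleftrightarrow> (\<exists>z. (move J ^^ m) a z \<and> piece J z b)" for m
  have "\<exists>m. P m"
    using chain_exists[OF J(1) a b] unfolding P_def by (metis rtranclp_power)
  define n where "n = (LEAST m. P m)"
  have Pn: "P n" using \<open>\<exists>m. P m\<close> unfolding n_def by (rule LeastI_ex)
  have least: "n \<le> m" if "P m" for m using that unfolding n_def by (rule Least_le)
  obtain f where f: "f 0 = a" "piece J (f n) b" "\<And>k. k < n \<Longrightarrow> move J (f k) (f (Suc k))"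
    using Pn unfolding P_def relpowp_fun_conv by blast
  then have "\<forall>k. \<exists>t i. k < n \<longrightarrow> piece J (f k) t \<and> jump i t (f (Suc k))"
    unfolding move_def by blast
  then obtain t0 idx where t0: "\<And>k. k < n \<Longrightarrow> piece J (f k) (t0 k) \<and> jump (idx k) (t0 k) (f (Suc k))"
    by metis
  \<comment> \<open>With the last piece ending at b, pieces run over \<open>k \<le> n\<close> and
    jumps over \<open>k < n\<close>.\<close>
  define t where "t = (\<lambda>k. if k = n then b else t0 k)"
  have pieces: "piece J (f k) (t k)" if "k \<le> n" for k
    using that f(2) t0[of k] by (auto simp: t_def)
  have jumps: "jump (idx k) (t k) (f (Suc k))" if "k < n" for k
    using that t0[of k] by (auto simp: t_def)
  have head: "(move J ^^ k) a (f k)" if "k \<le> n" for k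
    unfolding relpowp_fun_conv using that f by (intro exI[of _ f]) auto
  have tail: "(move J ^^ (n - k)) (f k) (f n)" if "k \<le> n" for k
    unfolding relpowp_fun_conv using that f by (intro exI[of _ "\<lambda>j. f (k + j)"]) auto
  \<comment> \<open>Leaving piece k by a jump and joining the end of piece l gives a chain with k +
    1 + (n - l) moves, for l = n as well as for l < n; minimality of n bounds l.\<close>
  have shortcut: "l \<le> Suc k"
    if "k \<le> n" "l \<le> n" "piece J (f k) p" "jump i p q" "piece J q (t l)" for k l p q i
  proof -
    have "move J (f k) q" using that by (auto simp: move_def)
    then have 1: "(move J ^^ Suc k) a q" using head[OF that(1)] by auto
    show ?thesis
    proof (cases "l = n")
      case True
      then have "P (Suc k)" using 1 that(5) by (auto simp: P_def t_def)
      then show ?thesis using least True by blast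
    next
      case False
      then have "move J q (f (Suc l))" using jumps[of l] that by (auto simp: move_def)
      then have "(move J ^^ Suc (Suc k)) a (f (Suc l))" using 1 by auto
      then have "(move J ^^ (Suc (Suc k) + (n - Suc l))) a (f n)"
        using tail[of "Suc l"] False that(2) unfolding relpowp_add by auto
      then have "P (Suc (Suc k) + (n - Suc l))" using f(2) by (auto simp: P_def)
      then show ?thesis using least[of "Suc (Suc k) + (n - Suc l)"] False that(2) by linarith
    qed
  qed
  \<comment> \<open>If the same disk were jumped twice, the first take-off and the second landing
    would lie on its boundary, and one jump between them would save l - k moves.\<close>
  have "idx k \<noteq> idx l" if kl: "k < l" "l < n" for k l
  proof
    assume "idx k = idx l"
    then have "jump (idx k) (t k) (f (Suc l))"
      using jumps[of k] jumps[of l] kl by (auto simp: jump_def)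
    then have "move J (f k) (f (Suc l))" using pieces[of k] kl by (auto simp: move_def)
    then have "(move J ^^ Suc k) a (f (Suc l))" using head[of k] kl by auto
    then have "(move J ^^ (Suc k + (n - Suc l))) a (f n)"
      using tail[of "Suc l"] kl unfolding relpowp_add by auto
    then have "P (Suc k + (n - Suc l))" using f(2) by (auto simp: P_def)
    then show False using least[of "Suc k + (n - Suc l)"] kl by linarith
  qed
  then have inj: "inj_on idx {..<n}"
    unfolding inj_on_def by (metis lessThan_iff linorder_less_linear)
  define h where "h k = hit (closed_segment (f k) (t k))" for k
  have I: "f k \<in> I" "t k \<in> I" "free (f k)" "free (t k)" if "k \<le> n" for k
    using pieces[OF that] by (auto simp: piece_def free_def)
  have hI: "h k \<subseteq> hit I - J" if "k \<le> n" for k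
    using pieces[OF that] hit_mono[OF segment_subset[OF I(1,2)]] that
    by (auto simp: piece_def h_def)
  \<comment> \<open>A disk met by two pieces offers a shortcut from its first contact in one to its
    last contact in the other. Jumps across disks outside J are allowed, so this applies to every
    disk met by a piece.\<close>
  have near: "l \<le> Suc k" if kl: "k \<le> n" "l \<le> n" and i: "i \<in> h k" "i \<in> h l" for i k l
  proof -
    obtain p where p: "p \<in> closed_segment (f k) (t k)" "\<gamma> p \<in> frontier (Q i)"
      using first_hit[OF I(3)[OF kl(1)] I(2)[OF kl(1)]] i(1) unfolding h_def by blast
    obtain q where q: "q \<in> closed_segment (t l) (f l)" "\<gamma> q \<in> frontier (Q i)"
      using first_hit[OF I(4)[OF kl(2)] I(1)[OF kl(2)]] i(2) unfolding h_def
      by (metis closed_segment_commute)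
    have pq: "p \<in> I" "q \<in> I" using p(1) q(1) segment_subset I kl by blast+
    have "piece J (f k) p" "piece J (t l) q"
      using pieces kl p q pq free_frontier piece_sub piece_commute by meson+
    moreover have "jump i p q" using hI[OF kl(1)] i pq p q by (auto simp: jump_def)
    ultimately show ?thesis using shortcut[OF kl] piece_commute by blast
  qed
  have card: "card {k \<in> {..n}. i \<in> h k} \<le> 2" for i
  proof (cases "{k \<in> {..n}. i \<in> h k} = {}")
    case False
    define k0 where "k0 = Min {k \<in> {..n}. i \<in> h k}"
    have k0: "k0 \<le> n" "i \<in> h k0"
      using Min_in[OF _ False] unfolding k0_def by auto
    have "k0 \<le> k" if "k \<le> n" "i \<in> h k" for k
      unfolding k0_def using that by (intro Min_le) auto
    then have "{k \<in> {..n}. i \<in> h k} \<subseteq> {k0, Suc k0}"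
      using near[OF k0(1) _ k0(2)] by (force simp: le_Suc_eq)
    then have "card {k \<in> {..n}. i \<in> h k} \<le> card {k0, Suc k0}" by (intro card_mono) auto
    then show ?thesis by simp
  qed (simp only: card.empty)
  have "(\<Sum>k\<le>n. ennreal \<bar>F (\<gamma> (f k)) - F (\<gamma> (t k))\<bar>) \<le> (\<Sum>k\<le>n. infsum \<rho> (h k))"
    using I by (intro sum_mono) (auto simp: h_def intro: ug)
  also have "\<dots> = (\<Sum>k\<le>n. infsum (\<lambda>i. if i \<in> h k then \<rho> i else 0) (hit I - J))"
  proof (rule sum.cong[OF refl])
    fix k assume "k \<in> {..n}"
    then have "h k \<subseteq> hit I - J" using hI by simp
    then show "infsum \<rho> (h k) = infsum (\<lambda>i. if i \<in> h k then \<rho> i else 0) (hit I - J)"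
      by (intro infsum_cong_neutral) auto
  qed
  also have "\<dots> = infsum (\<lambda>i. \<Sum>k\<le>n. if i \<in> h k then \<rho> i else 0) (hit I - J)"
    by (intro sum_infsum_ennreal) simp
  also have "\<dots> \<le> infsum (\<lambda>i. 2 * \<rho> i) (hit I - J)"
  proof (rule infsum_ennreal_mono)
    fix i
    have "(\<Sum>k\<le>n. if i \<in> h k then \<rho> i else 0) = of_nat (card {k \<in> {..n}. i \<in> h k}) * \<rho> i"
      by (subst sum.inter_filter[symmetric]) auto
    also have "\<dots> \<le> of_nat 2 * \<rho> i" by (intro mult_right_mono of_nat_mono card) simp
    finally show "(\<Sum>k\<le>n. if i \<in> h k then \<rho> i else 0) \<le> 2 * \<rho> i" by simp
  qed
  also have "\<dots> = 2 * infsum \<rho> (hit I - J)" by (rule infsum_ennreal_cmult)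
  also have "\<dots> \<le> 2 * ennreal (e / 2)" by (intro mult_left_mono J(2)) simp
  also have "\<dots> = ennreal e" using e by (simp flip: ennreal_numeral ennreal_mult)
  finally have small: "(\<Sum>k\<le>n. ennreal \<bar>F (\<gamma> (f k)) - F (\<gamma> (t k))\<bar>) \<le> ennreal e" .
  have "(\<Sum>k<n. ennreal \<bar>F (\<gamma> (t k)) - F (\<gamma> (f (Suc k)))\<bar>) \<le> (\<Sum>k<n. c (idx k))"
    using jumps by (intro sum_mono osc) (auto simp: jump_def)
  also have "\<dots> = sum c (idx ` {..<n})" using inj by (simp add: sum.reindex)
  also have "\<dots> \<le> infsum c (hit I)"
    using jumps by (intro sum_le_infsum_ennreal) (auto simp: jump_def)
  finally have big: "(\<Sum>k<n. ennreal \<bar>F (\<gamma> (t k)) - F (\<gamma> (f (Suc k)))\<bar>) \<le> infsum c (hit I)" .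
  have "ennreal \<bar>F (\<gamma> a) - F (\<gamma> b)\<bar> \<le> ennreal e + infsum c (hit I)"
    using order_trans[OF ennreal_abs_diff_chain[of "\<lambda>k. F (\<gamma> (f k))" "\<lambda>k. F (\<gamma> (t k))" n]
        add_mono[OF small big]] f(1) by (simp add: t_def)
  then show "ennreal \<bar>F (\<gamma> a) - F (\<gamma> b)\<bar> \<le> infsum c (hit I) + ennreal e"
    by (simp add: add.commute)
qed

end

section \<open>Exceptional path families\<close>

text \<open>A common form of the constraints in the weak and the strong modulus, so that null
  families of both versions can be treated through \<open>carpet_mod_zero_iff\<close>.\<close>

definition admissible ::
  "version \<Rightarrow> complex set \<Rightarrow> (nat \<Rightarrow> complex set) \<Rightarrow> cpath set \<Rightarrow> (nat \<Rightarrow> real) \<Rightarrow> bool" where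
  "admissible v \<Omega> Q \<Gamma> \<rho> \<longleftrightarrow> (\<forall>i. 0 \<le> \<rho> i) \<and>
     (case v of
        Weak \<Rightarrow> \<exists>\<Gamma>0\<subseteq>\<Gamma>. mod_2 \<Gamma>0 = 0 \<and>
          (\<forall>\<gamma>\<in>\<Gamma> - \<Gamma>0. 1 \<le> (\<Sum>\<^sub>\<infinity>i\<in>meeting Q (path_trace \<gamma>). ennreal (\<rho> i)))
      | Strong \<Rightarrow> \<forall>\<gamma>\<in>\<Gamma>. hausdorff_outer 1 (path_trace \<gamma> \<inter> carpet \<Omega> Q) = 0 \<longrightarrow>
          1 \<le> (\<Sum>\<^sub>\<infinity>i\<in>meeting Q (path_trace \<gamma>). ennreal (\<rho> i)))"

lemma carpet_mod_admissible:
  "carpet_mod v \<Omega> Q \<Gamma> = (INF \<rho>\<in>Collect (admissible v \<Omega> Q \<Gamma>). \<Sum>\<^sub>\<infinity>i. ennreal ((\<rho> i)\<^sup>2))"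
  by (cases v) (simp_all add: mod_weak_def mod_strong_def admissible_def[abs_def])

lemma carpet_mod_zero_iff:
  "carpet_mod v \<Omega> Q \<Gamma> = 0 \<longleftrightarrow>
     (\<forall>e>0. \<exists>\<rho>. admissible v \<Omega> Q \<Gamma> \<rho> \<and> (\<Sum>\<^sub>\<infinity>i. ennreal ((\<rho> i)\<^sup>2)) < ennreal e)"
    (is "?L \<longleftrightarrow> ?R")
proof
  assume ?L
  then have "(INF \<rho>\<in>Collect (admissible v \<Omega> Q \<Gamma>). \<Sum>\<^sub>\<infinity>i. ennreal ((\<rho> i)\<^sup>2)) < ennreal e" if "0 < e" for e
    using that by (simp add: carpet_mod_admissible)
  then show ?R by (auto simp: INF_less_iff)
next
  assume R: ?R
  have "carpet_mod v \<Omega> Q \<Gamma> \<le> 0 + ennreal e" if e: "0 < e" for e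
  proof -
    obtain \<rho> where "admissible v \<Omega> Q \<Gamma> \<rho>" "(\<Sum>\<^sub>\<infinity>i. ennreal ((\<rho> i)\<^sup>2)) < ennreal e"
      using R e by blast
    then show ?thesis
      unfolding carpet_mod_admissible by (intro INF_lower2[of \<rho>]) auto
  qed
  then have "carpet_mod v \<Omega> Q \<Gamma> \<le> 0" by (rule ennreal_le_epsilon)
  then show ?L by simp
qed

section \<open>Superpaths, unions and divergent sums\<close>

lemma path_trace_subpath: "subpath_of \<gamma>' \<gamma> \<Longrightarrow> path_trace \<gamma>' \<subseteq> path_trace \<gamma>"
  by (auto simp: subpath_of_def path_trace_def)

lemma meeting_mono: "A \<subseteq> B \<Longrightarrow> meeting Q A \<subseteq> meeting Q B"
  by (auto simp: meeting_def)

lemma locally_rectifiable_subpath: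
  "subpath_of \<gamma>' \<gamma> \<Longrightarrow> locally_rectifiable \<gamma> \<Longrightarrow> locally_rectifiable \<gamma>'"
  unfolding locally_rectifiable_def subpath_of_def by (metis order_trans)

text \<open>\<open>line_integral\<close> is a supremum over compact parameter intervals, of which a
  subpath has fewer; if the longer path is not locally rectifiable, the bound is infinite.\<close>

lemma line_integral_subpath:
  assumes "subpath_of \<gamma>' \<gamma>"
  shows "line_integral h \<gamma>' \<le> line_integral h \<gamma>"
proof (cases "locally_rectifiable \<gamma>")
  case True
  have "snd \<gamma>' = snd \<gamma>" "fst \<gamma>' \<subseteq> fst \<gamma>" using assms by (auto simp: subpath_of_def)
  then show ?thesis
    using True locally_rectifiable_subpath[OF assms True]
    by (auto simp: line_integral_def intro!: SUP_subset_mono)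
qed (simp add: line_integral_def)

lemma mod_2_superpaths:
  assumes "mod_2 \<Gamma> = 0" "\<And>\<gamma>. \<gamma> \<in> \<Gamma>' \<Longrightarrow> \<exists>\<gamma>'\<in>\<Gamma>. subpath_of \<gamma>' \<gamma>"
  shows "mod_2 \<Gamma>' = 0"
proof -
  have "mod_2 \<Gamma>' \<le> mod_2 \<Gamma>"
    unfolding mod_2_def
  proof (intro INF_superset_mono subsetI CollectI conjI ballI)
    fix h \<gamma> assume h: "h \<in> {h \<in> borel_measurable borel. \<forall>\<gamma>\<in>\<Gamma>. line_integral h \<gamma> \<ge> 1}" and "\<gamma> \<in> \<Gamma>'"
    then obtain \<gamma>' where "\<gamma>' \<in> \<Gamma>" "subpath_of \<gamma>' \<gamma>" using assms(2) by blast
    then show "1 \<le> line_integral h \<gamma>"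
      using h line_integral_subpath[of \<gamma>' \<gamma> h] by (auto intro: order_trans)
  qed auto
  then show ?thesis using assms(1) by simp
qed

lemma line_integral_mono:
  assumes "\<And>z. h z \<le> k z"
  shows "line_integral h \<gamma> \<le> line_integral k \<gamma>"
  unfolding line_integral_def using assms
  by (auto intro!: SUP_mono' nn_integral_mono mult_right_mono)

text \<open>The pointwise maximum of two densities serves both families, and its square is at most
  the sum of the squares.\<close>

lemma mod_2_Un:
  assumes "mod_2 \<Gamma> = 0" "mod_2 \<Gamma>' = 0"
  shows "mod_2 (\<Gamma> \<union> \<Gamma>') = 0"
proof -
  have ex: "\<exists>h\<in>borel_measurable borel. (\<forall>\<gamma>\<in>G. line_integral h \<gamma> \<ge> 1) \<and>
      (\<integral>\<^sup>+ z. (h z)\<^sup>2 \<partial>hausdorff 2) < ennreal e" if "mod_2 G = 0" "0 < e" for G e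
  proof -
    have "mod_2 G < ennreal e" using that by simp
    then show ?thesis unfolding mod_2_def INF_less_iff by auto
  qed
  have "mod_2 (\<Gamma> \<union> \<Gamma>') \<le> 0 + ennreal e" if e: "0 < e" for e
  proof -
    obtain h where h: "h \<in> borel_measurable borel" "\<forall>\<gamma>\<in>\<Gamma>. line_integral h \<gamma> \<ge> 1"
        "(\<integral>\<^sup>+ z. (h z)\<^sup>2 \<partial>hausdorff 2) < ennreal (e / 2)"
      using ex[OF assms(1), of "e / 2"] e by auto
    obtain k where k: "k \<in> borel_measurable borel" "\<forall>\<gamma>\<in>\<Gamma>'. line_integral k \<gamma> \<ge> 1"
        "(\<integral>\<^sup>+ z. (k z)\<^sup>2 \<partial>hausdorff 2) < ennreal (e / 2)"
      using ex[OF assms(2), of "e / 2"] e by auto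
    define l where "l = (\<lambda>z. max (h z) (k z))"
    have [measurable]: "h \<in> borel_measurable borel" "k \<in> borel_measurable borel" by fact+
    have "line_integral h \<gamma> \<le> line_integral l \<gamma>" "line_integral k \<gamma> \<le> line_integral l \<gamma>" for \<gamma>
      by (intro line_integral_mono; simp add: l_def)+
    then have "\<forall>\<gamma>\<in>\<Gamma> \<union> \<Gamma>'. line_integral l \<gamma> \<ge> 1"
      using h(2) k(2) by (blast intro: order_trans)
    moreover have "l \<in> borel_measurable borel" unfolding l_def by measurable
    ultimately have "mod_2 (\<Gamma> \<union> \<Gamma>') \<le> (\<integral>\<^sup>+ z. (l z)\<^sup>2 \<partial>hausdorff 2)"
      unfolding mod_2_def by (intro INF_lower) auto
    also have "\<dots> \<le> (\<integral>\<^sup>+ z. (h z)\<^sup>2 + (k z)\<^sup>2 \<partial>hausdorff 2)"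
      by (intro nn_integral_mono) (auto simp: l_def max_def)
    also have "\<dots> = (\<integral>\<^sup>+ z. (h z)\<^sup>2 \<partial>hausdorff 2) + (\<integral>\<^sup>+ z. (k z)\<^sup>2 \<partial>hausdorff 2)"
      by (intro nn_integral_add) auto
    also have "\<dots> \<le> ennreal (e / 2) + ennreal (e / 2)"
      using h(3) k(3) by (intro add_mono) auto
    also have "\<dots> = ennreal e" using e by (simp flip: ennreal_plus)
    finally show ?thesis by simp
  qed
  then have "mod_2 (\<Gamma> \<union> \<Gamma>') \<le> 0" by (rule ennreal_le_epsilon)
  then show ?thesis by simp
qed

lemma mod_2_empty: "mod_2 {} = 0"
proof -
  have "mod_2 {} \<le> (\<integral>\<^sup>+ z. ((\<lambda>_. 0) z)\<^sup>2 \<partial>(hausdorff 2 :: complex measure))"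
    unfolding mod_2_def by (intro INF_lower) auto
  then show ?thesis by simp
qed

text \<open>Allows every path with an exceptional subpath to be discarded, after which all subpaths
  of a remaining path are good. Lengthening a path only enlarges its sum of weights; in the strong
  version the condition on \<open>hausdorff_outer 1\<close> passes from a path to its
  subpaths.\<close>

lemma carpet_mod_superpaths:
  assumes zero: "carpet_mod v \<Omega> Q \<Gamma> = 0"
    and sub: "\<And>\<gamma>. \<gamma> \<in> \<Gamma>' \<Longrightarrow> \<exists>\<gamma>'\<in>\<Gamma>. subpath_of \<gamma>' \<gamma>"
  shows "carpet_mod v \<Omega> Q \<Gamma>' = 0"
proof -
  have sum: "infsum f (meeting Q (path_trace \<gamma>')) \<le> infsum f (meeting Q (path_trace \<gamma>))"
    if "subpath_of \<gamma>' \<gamma>" for \<gamma>' \<gamma> and f :: "nat \<Rightarrow> ennreal"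
    by (intro infsum_ennreal_subset meeting_mono path_trace_subpath that)
  have "admissible v \<Omega> Q \<Gamma>' \<rho>" if adm: "admissible v \<Omega> Q \<Gamma> \<rho>" for \<rho>
  proof (cases v)
    case Weak
    then obtain \<Gamma>0 where \<Gamma>0: "\<Gamma>0 \<subseteq> \<Gamma>" "mod_2 \<Gamma>0 = 0"
        "\<And>\<gamma>. \<gamma> \<in> \<Gamma> - \<Gamma>0 \<Longrightarrow> 1 \<le> (\<Sum>\<^sub>\<infinity>i\<in>meeting Q (path_trace \<gamma>). ennreal (\<rho> i))"
      using adm unfolding admissible_def by auto
    \<comment> \<open>The part of the new family for which no subpath can be used if it lies in
      \<open>\<Gamma>0\<close>; it is null by the same statement for \<open>mod_2\<close>.\<close>
    let ?G = "{\<gamma> \<in> \<Gamma>'. \<exists>\<gamma>'\<in>\<Gamma>0. subpath_of \<gamma>' \<gamma>}"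
    have "mod_2 ?G = 0" using \<Gamma>0(2) by (rule mod_2_superpaths) auto
    moreover have "1 \<le> (\<Sum>\<^sub>\<infinity>i\<in>meeting Q (path_trace \<gamma>). ennreal (\<rho> i))" if "\<gamma> \<in> \<Gamma>' - ?G" for \<gamma>
    proof -
      obtain \<gamma>' where "\<gamma>' \<in> \<Gamma>" "subpath_of \<gamma>' \<gamma>" using sub \<open>\<gamma> \<in> \<Gamma>' - ?G\<close> by blast
      then show ?thesis using \<Gamma>0(3)[of \<gamma>'] sum that by (blast intro: order_trans)
    qed
    ultimately show ?thesis
      using Weak adm unfolding admissible_def by (auto intro!: exI[of _ ?G])
  next
    case Strong
    show ?thesis
      unfolding admissible_def Strong version.case
    proof (intro conjI ballI impI)
      fix \<gamma> assume \<gamma>: "\<gamma> \<in> \<Gamma>'" "hausdorff_outer 1 (path_trace \<gamma> \<inter> carpet \<Omega> Q) = 0"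
      obtain \<gamma>' where \<gamma>': "\<gamma>' \<in> \<Gamma>" "subpath_of \<gamma>' \<gamma>" using sub \<gamma>(1) by blast
      have "hausdorff_outer 1 (path_trace \<gamma>' \<inter> carpet \<Omega> Q) \<le>
          hausdorff_outer 1 (path_trace \<gamma> \<inter> carpet \<Omega> Q)"
        using path_trace_subpath[OF \<gamma>'(2)] by (intro hausdorff_outer_mono) auto
      then have "1 \<le> (\<Sum>\<^sub>\<infinity>i\<in>meeting Q (path_trace \<gamma>'). ennreal (\<rho> i))"
        using adm \<gamma>'(1) \<gamma>(2) by (auto simp: admissible_def Strong)
      also note sum[OF \<gamma>'(2)]
      finally show "1 \<le> (\<Sum>\<^sub>\<infinity>i\<in>meeting Q (path_trace \<gamma>). ennreal (\<rho> i))" .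
    qed (use adm in \<open>auto simp: admissible_def\<close>)
  qed
  then show ?thesis using zero unfolding carpet_mod_zero_iff by blast
qed

lemma carpet_mod_Un:
  assumes "carpet_mod v \<Omega> Q \<Gamma> = 0" "carpet_mod v \<Omega> Q \<Gamma>' = 0"
  shows "carpet_mod v \<Omega> Q (\<Gamma> \<union> \<Gamma>') = 0"
  unfolding carpet_mod_zero_iff
proof (intro allI impI)
  fix e :: real assume e: "0 < e"
  obtain \<rho> where \<rho>: "admissible v \<Omega> Q \<Gamma> \<rho>" "(\<Sum>\<^sub>\<infinity>i. ennreal ((\<rho> i)\<^sup>2)) < ennreal (e / 2)"
    using assms(1) half_gt_zero[OF e] unfolding carpet_mod_zero_iff by blast
  obtain \<sigma> where \<sigma>: "admissible v \<Omega> Q \<Gamma>' \<sigma>" "(\<Sum>\<^sub>\<infinity>i. ennreal ((\<sigma> i)\<^sup>2)) < ennreal (e / 2)"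
    using assms(2) half_gt_zero[OF e] unfolding carpet_mod_zero_iff by blast
  define \<tau> where "\<tau> = (\<lambda>i. max (\<rho> i) (\<sigma> i))"
  have le: "infsum (\<lambda>i. ennreal (\<rho> i)) A \<le> infsum (\<lambda>i. ennreal (\<tau> i)) A"
       "infsum (\<lambda>i. ennreal (\<sigma> i)) A \<le> infsum (\<lambda>i. ennreal (\<tau> i)) A" for A
    by (intro infsum_ennreal_mono ennreal_leI; simp add: \<tau>_def)+
  have "admissible v \<Omega> Q (\<Gamma> \<union> \<Gamma>') \<tau>"
  proof (cases v)
    case Weak
    obtain G where G: "G \<subseteq> \<Gamma>" "mod_2 G = 0"
        "\<And>\<gamma>. \<gamma> \<in> \<Gamma> - G \<Longrightarrow> 1 \<le> (\<Sum>\<^sub>\<infinity>i\<in>meeting Q (path_trace \<gamma>). ennreal (\<rho> i))"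
      using \<rho>(1) Weak unfolding admissible_def by auto
    obtain H where H: "H \<subseteq> \<Gamma>'" "mod_2 H = 0"
        "\<And>\<gamma>. \<gamma> \<in> \<Gamma>' - H \<Longrightarrow> 1 \<le> (\<Sum>\<^sub>\<infinity>i\<in>meeting Q (path_trace \<gamma>). ennreal (\<sigma> i))"
      using \<sigma>(1) Weak unfolding admissible_def by auto
    have "1 \<le> (\<Sum>\<^sub>\<infinity>i\<in>meeting Q (path_trace \<gamma>). ennreal (\<tau> i))" if "\<gamma> \<in> \<Gamma> \<union> \<Gamma>' - (G \<union> H)" for \<gamma>
      using that G(3)[of \<gamma>] H(3)[of \<gamma>] le by (auto intro: order_trans)
    moreover have "mod_2 (G \<union> H) = 0" by (rule mod_2_Un[OF G(2) H(2)])
    moreover have "G \<union> H \<subseteq> \<Gamma> \<union> \<Gamma>'" using G(1) H(1) by blast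
    moreover have "0 \<le> \<tau> i" for i using \<rho>(1) by (simp add: admissible_def \<tau>_def le_max_iff_disj)
    ultimately show ?thesis
      unfolding admissible_def Weak version.case by blast
  next
    case Strong
    have "0 \<le> \<tau> i" for i using \<rho>(1) by (simp add: admissible_def \<tau>_def le_max_iff_disj)
    then show ?thesis
      using \<rho>(1) \<sigma>(1) le unfolding admissible_def Strong version.case
      by (auto intro: order_trans)
  qed
  moreover have "(\<Sum>\<^sub>\<infinity>i. ennreal ((\<tau> i)\<^sup>2)) < ennreal e"
  proof -
    have "(\<Sum>\<^sub>\<infinity>i. ennreal ((\<tau> i)\<^sup>2)) \<le> (\<Sum>\<^sub>\<infinity>i. ennreal ((\<rho> i)\<^sup>2) + ennreal ((\<sigma> i)\<^sup>2))"
      by (intro infsum_ennreal_mono) (auto simp: \<tau>_def max_def)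
    also have "\<dots> = (\<Sum>\<^sub>\<infinity>i. ennreal ((\<rho> i)\<^sup>2)) + (\<Sum>\<^sub>\<infinity>i. ennreal ((\<sigma> i)\<^sup>2))"
      by (rule infsum_ennreal_add)
    also have "\<dots> < ennreal (e / 2) + ennreal (e / 2)"
      using \<rho>(2) \<sigma>(2) by (rule add_strict_mono)
    also have "\<dots> = ennreal e" using e by (simp flip: ennreal_plus)
    finally show ?thesis .
  qed
  ultimately show "\<exists>\<rho>. admissible v \<Omega> Q (\<Gamma> \<union> \<Gamma>') \<rho> \<and> (\<Sum>\<^sub>\<infinity>i. ennreal ((\<rho> i)\<^sup>2)) < ennreal e"
    by blast
qed

text \<open>Every positive multiple of the weight still has infinite sum along the paths, hence is
  admissible, while its energy can be made arbitrarily small.\<close>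

lemma carpet_mod_divergent:
  fixes \<rho> :: "nat \<Rightarrow> real"
  assumes nonneg: "\<And>i. 0 \<le> \<rho> i" and fin: "(\<Sum>\<^sub>\<infinity>i. ennreal ((\<rho> i)\<^sup>2)) < \<infinity>"
    and div: "\<And>\<gamma>. \<gamma> \<in> \<Gamma> \<Longrightarrow> (\<Sum>\<^sub>\<infinity>i\<in>meeting Q (path_trace \<gamma>). ennreal (\<rho> i)) = \<infinity>"
  shows "carpet_mod v \<Omega> Q \<Gamma> = 0"
  unfolding carpet_mod_zero_iff
proof (intro allI impI)
  fix e :: real assume e: "0 < e"
  obtain R where R: "0 \<le> R" "(\<Sum>\<^sub>\<infinity>i. ennreal ((\<rho> i)\<^sup>2)) = ennreal R"
    using fin by (cases "\<Sum>\<^sub>\<infinity>i. ennreal ((\<rho> i)\<^sup>2)") auto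
  \<comment> \<open>Chosen so that \<open>d^2 * R\<close> is less than e; R + 1 covers the case R =
    0.\<close>
  define d where "d = sqrt (e / (2 * (R + 1)))"
  have d: "0 < d" "d\<^sup>2 * R < e"
  proof -
    show "0 < d" using e R(1) by (simp add: d_def)
    have "d\<^sup>2 * R = e * (R / (2 * (R + 1)))" using e R(1) by (simp add: d_def)
    also have "\<dots> < e * 1" using e R(1) by (intro mult_strict_left_mono) (auto simp: field_simps)
    finally show "d\<^sup>2 * R < e" by simp
  qed
  have "(\<Sum>\<^sub>\<infinity>i\<in>meeting Q (path_trace \<gamma>). ennreal (d * \<rho> i)) = \<infinity>" if "\<gamma> \<in> \<Gamma>" for \<gamma>
    using div[OF that] d(1) nonneg
    by (simp add: ennreal_mult infsum_ennreal_cmult ennreal_mult_eq_top_iff)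
  then have "admissible v \<Omega> Q \<Gamma> (\<lambda>i. d * \<rho> i)"
    using d(1) nonneg mod_2_empty
    by (cases v) (auto simp: admissible_def intro!: exI[of _ "{}"])
  moreover have "(\<Sum>\<^sub>\<infinity>i. ennreal ((d * \<rho> i)\<^sup>2)) < ennreal e"
  proof -
    have "(\<Sum>\<^sub>\<infinity>i. ennreal ((d * \<rho> i)\<^sup>2)) = (\<Sum>\<^sub>\<infinity>i. ennreal (d\<^sup>2) * ennreal ((\<rho> i)\<^sup>2))"
      by (simp only: power_mult_distrib ennreal_mult zero_le_power2)
    also have "\<dots> = ennreal (d\<^sup>2 * R)"
      using R(1) by (simp only: infsum_ennreal_cmult R(2) ennreal_mult zero_le_power2)
    also have "\<dots> < ennreal e" using d(2) e by (intro ennreal_lessI)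
    finally show ?thesis .
  qed
  ultimately show "\<exists>\<rho>. admissible v \<Omega> Q \<Gamma> \<rho> \<and> (\<Sum>\<^sub>\<infinity>i. ennreal ((\<rho> i)\<^sup>2)) < ennreal e"
    by blast
qed

section \<open>Upper gradients by oscillations\<close>

lemma osc_Q_ge:
  fixes f :: "complex \<Rightarrow> real"
  assumes "x \<in> frontier (Q i)" "y \<in> frontier (Q i)"
  shows "ennreal \<bar>f x - f y\<bar> \<le> osc_Q Q (\<lambda>x. ereal (f x)) i"
proof -
  have "ennreal (f x - f y) \<le> osc_Q Q (\<lambda>x. ereal (f x)) i"
    if "x \<in> frontier (Q i)" "y \<in> frontier (Q i)" for x y
  proof -
    have "ereal (f x) - ereal (f y) \<le> M_Q Q (\<lambda>x. ereal (f x)) i - m_Q Q (\<lambda>x. ereal (f x)) i"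
      unfolding M_Q_def m_Q_def using that by (intro ereal_minus_mono SUP_upper INF_lower)
    then show ?thesis
      unfolding osc_Q_def by (metis e2ennreal_mono ereal_minus(1) e2ennreal_ereal)
  qed
  from this[OF assms] this[OF assms(2,1)] show ?thesis by (auto simp: abs_if)
qed

context
  fixes Q :: "nat \<Rightarrow> complex set" and f :: "complex \<Rightarrow> real" and i :: nat
  assumes ne: "frontier (Q i) \<noteq> {}"
begin

lemma bounded_M_Q:
  assumes "\<bar>M_Q Q (\<lambda>x. ereal (f x)) i\<bar> \<noteq> \<infinity>" "\<bar>m_Q Q (\<lambda>x. ereal (f x)) i\<bar> \<noteq> \<infinity>"
  shows "bdd_above (f ` frontier (Q i))" "bdd_below (f ` frontier (Q i))"
proof -
  obtain M where M: "M_Q Q (\<lambda>x. ereal (f x)) i = ereal M"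
    using assms(1) by (cases "M_Q Q (\<lambda>x. ereal (f x)) i") auto
  obtain m where m: "m_Q Q (\<lambda>x. ereal (f x)) i = ereal m"
    using assms(2) by (cases "m_Q Q (\<lambda>x. ereal (f x)) i") auto
  have "f x \<le> M" "m \<le> f x" if "x \<in> frontier (Q i)" for x
    using that SUP_upper[of x "frontier (Q i)" "\<lambda>x. ereal (f x)"]
      INF_lower[of x "frontier (Q i)" "\<lambda>x. ereal (f x)"] M m
    unfolding M_Q_def m_Q_def by auto
  then show "bdd_above (f ` frontier (Q i))" "bdd_below (f ` frontier (Q i))"
    by (auto intro!: bdd_aboveI2[of _ _ M] bdd_belowI2[of _ m])
qed

lemma M_Q_ereal:
  assumes "bdd_above (f ` frontier (Q i))"
  shows "M_Q Q (\<lambda>x. ereal (f x)) i = ereal (SUP x\<in>frontier (Q i). f x)"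
  unfolding M_Q_def using ne assms
proof (intro SUP_eqI)
  fix y assume y: "\<And>x. x \<in> frontier (Q i) \<Longrightarrow> ereal (f x) \<le> y"
  show "ereal (SUP x\<in>frontier (Q i). f x) \<le> y"
    using ne y by (cases y) (auto intro!: cSUP_least)
qed (auto intro: cSUP_upper)

lemma m_Q_ereal:
  assumes "bdd_below (f ` frontier (Q i))"
  shows "m_Q Q (\<lambda>x. ereal (f x)) i = ereal (INF x\<in>frontier (Q i). f x)"
  unfolding m_Q_def using ne assms
proof (intro INF_eqI)
  fix y assume y: "\<And>x. x \<in> frontier (Q i) \<Longrightarrow> y \<le> ereal (f x)"
  show "y \<le> ereal (INF x\<in>frontier (Q i). f x)"
    using ne y by (cases y) (auto intro!: cINF_greatest)
qed (auto intro: cINF_lower)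

end

text \<open>
  A single square summable weight that dominates a multiple of \<open>w\<close> on every compact set makes
  countable subadditivity of the moduli unnecessary.
\<close>

lemma weighted_square_summable:
  fixes w :: "nat \<Rightarrow> real"
  assumes \<Omega>: "open \<Omega>" and Q: "\<And>i. Q i \<noteq> {}" "\<And>i. Q i \<subseteq> \<Omega>" and nonneg: "\<And>i. 0 \<le> w i"
    and loc: "\<And>x r. 0 < r \<Longrightarrow> compactly_in (ball x r) \<Omega> \<Longrightarrow>
      (\<Sum>\<^sub>\<infinity>i\<in>meeting Q (ball x r). ennreal ((w i)\<^sup>2)) < \<infinity>"
  shows "\<exists>\<rho>. (\<forall>i. 0 \<le> \<rho> i) \<and> (\<Sum>\<^sub>\<infinity>i. ennreal ((\<rho> i)\<^sup>2)) < \<infinity> \<and>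
    (\<forall>K. compact K \<longrightarrow> K \<subseteq> \<Omega> \<longrightarrow> (\<exists>c>0. \<forall>i\<in>meeting Q K. w i \<le> c * \<rho> i))"
proof -
  let ?\<B> = "{ball x r |x r. 0 < r \<and> cball x r \<subseteq> \<Omega>}"
  obtain \<B> where \<B>: "\<B> \<subseteq> ?\<B>" "countable \<B>" "\<Union>\<B> = \<Union>?\<B>"
    using Lindelof[of ?\<B>] by auto
  have un: "\<Union>?\<B> = \<Omega>"
  proof
    show "\<Omega> \<subseteq> \<Union>?\<B>"
    proof
      fix x assume "x \<in> \<Omega>"
      then obtain r where "0 < r" "cball x r \<subseteq> \<Omega>" using \<Omega> open_contains_cball by blast
      then have "ball x r \<in> ?\<B>" "x \<in> ball x r" by auto
      then show "x \<in> \<Union>?\<B>" by blast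
    qed
  qed (use ball_subset_cball in blast)
  have ne: "\<B> \<noteq> {}" using \<B>(3) un Q[of 0] by auto
  define B where "B = from_nat_into \<B>"
  have "range B = \<B>" using range_from_nat_into[OF ne \<B>(2)] by (simp add: B_def)
  then have B: "\<Union>(range B) = \<Omega>" "B n \<in> ?\<B>" for n
    using \<B>(1,3) un by (metis, blast)
  have opB: "open (B n)" for n using B(2)[of n] by auto
  define s where "s n = enn2real (\<Sum>\<^sub>\<infinity>i\<in>meeting Q (B n). ennreal ((w i)\<^sup>2))" for n
  have s: "(\<Sum>\<^sub>\<infinity>i\<in>meeting Q (B n). ennreal ((w i)\<^sup>2)) = ennreal (s n)" for n
  proof -
    obtain x r where "B n = ball x r" "0 < r" "cball x r \<subseteq> \<Omega>" using B(2)[of n] by blast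
    then have "(\<Sum>\<^sub>\<infinity>i\<in>meeting Q (B n). ennreal ((w i)\<^sup>2)) < \<infinity>"
      using loc[of r x] by (simp add: compactly_in_def)
    then show ?thesis unfolding s_def by simp
  qed
  have s0: "0 \<le> s n" for n by (simp add: s_def)
  \<comment> \<open>The damping reduces the energy charged to the n-th ball to at most
    \<open>(1 / 2) ^ n\<close>.\<close>
  define c where "c n = (1 / 2) ^ n / (1 + s n)" for n
  have c0: "0 < c n" for n using s0[of n] by (simp add: c_def)
  \<comment> \<open>Each disk is charged only to the first ball that it meets, so overlaps of the
    balls do no harm.\<close>
  define N where "N i = (LEAST n. i \<in> meeting Q (B n))" for i
  have "\<exists>n. i \<in> meeting Q (B n)" for i
    using Q[of i] B(1) by (fastforce simp: meeting_def)
  then have N: "i \<in> meeting Q (B (N i))" for i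
    unfolding N_def by (rule LeastI_ex)
  define \<rho> where "\<rho> i = c (N i) * w i" for i
  have "sum (\<lambda>i. ennreal ((\<rho> i)\<^sup>2)) F \<le> ennreal 2" if F: "finite F" for F
  proof -
    have block: "(\<Sum>i | i \<in> F \<and> N i = n. (\<rho> i)\<^sup>2) \<le> (1 / 2) ^ n" for n
    proof -
      have "ennreal (\<Sum>i | i \<in> F \<and> N i = n. (w i)\<^sup>2) = (\<Sum>i | i \<in> F \<and> N i = n. ennreal ((w i)\<^sup>2))"
        by (simp add: sum_ennreal)
      also have "\<dots> \<le> ennreal (s n)"
        unfolding s[symmetric] using F N by (intro sum_le_infsum_ennreal) auto
      finally have "(\<Sum>i | i \<in> F \<and> N i = n. (w i)\<^sup>2) \<le> s n"
        using s0 by (simp add: ennreal_le_iff)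
      then have "(\<Sum>i | i \<in> F \<and> N i = n. (\<rho> i)\<^sup>2) \<le> (c n)\<^sup>2 * s n"
        using mult_left_mono[of _ "s n" "(c n)\<^sup>2"]
        by (simp add: \<rho>_def power_mult_distrib sum_distrib_left[symmetric])
      also have "\<dots> = ((1 / 2) ^ n)\<^sup>2 * (s n / (1 + s n)\<^sup>2)"
        by (simp add: c_def power_divide power_mult_distrib)
      also have "\<dots> \<le> (1 / 2) ^ n * 1"
      proof (rule mult_mono)
        show "((1 / 2) ^ n)\<^sup>2 \<le> (1 / 2 :: real) ^ n"
          by (simp add: power2_eq_square mult_left_le power_le_one)
        show "s n / (1 + s n)\<^sup>2 \<le> 1"
          using s0[of n] by (simp add: power2_eq_square algebra_simps add_pos_nonneg)
      qed (use s0[of n] in auto)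
      finally show ?thesis by simp
    qed
    have "(\<Sum>i\<in>F. (\<rho> i)\<^sup>2) = (\<Sum>n\<in>N ` F. \<Sum>i | i \<in> F \<and> N i = n. (\<rho> i)\<^sup>2)"
      using F by (rule sum.image_gen)
    also have "\<dots> \<le> (\<Sum>n\<in>N ` F. (1 / 2) ^ n)" by (intro sum_mono block)
    also have "\<dots> \<le> (\<Sum>n. (1 / 2) ^ n)"
      using F by (intro sum_le_suminf) auto
    also have "\<dots> = 2" by (simp add: suminf_geometric)
    finally have "ennreal (\<Sum>i\<in>F. (\<rho> i)\<^sup>2) \<le> ennreal 2" by (rule ennreal_leI)
    then show ?thesis by (simp add: sum_ennreal)
  qed
  then have "(\<Sum>\<^sub>\<infinity>i. ennreal ((\<rho> i)\<^sup>2)) \<le> ennreal 2" by (intro infsum_ennreal_leI)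
  then have sum: "(\<Sum>\<^sub>\<infinity>i. ennreal ((\<rho> i)\<^sup>2)) < \<infinity>" by (simp add: le_less_trans)
  have "\<exists>d>0. \<forall>i\<in>meeting Q K. w i \<le> d * \<rho> i" if K: "compact K" "K \<subseteq> \<Omega>" for K
  proof -
    obtain D where D: "finite D" "K \<subseteq> (\<Union>n\<in>D. B n)"
      using compactE_image[OF K(1), of UNIV B] opB K(2) B(1) by auto
    \<comment> \<open>A disk meeting K is charged to one of the balls up to m, so only finitely many
      damping factors have to be undone.\<close>
    obtain m where m: "D \<subseteq> {..m}" using D(1) finite_nat_iff_bounded_le by blast
    define d where "d = (\<Sum>n\<le>m. 1 / c n)"
    have "w i \<le> d * \<rho> i" if i: "i \<in> meeting Q K" for i
    proof -
      obtain n where "n \<in> D" "i \<in> meeting Q (B n)"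
        using i D(2) by (fastforce simp: meeting_def)
      then have "N i \<le> m" using m Least_le[of "\<lambda>n. i \<in> meeting Q (B n)" n] unfolding N_def by force
      then have "1 / c (N i) \<le> d"
        unfolding d_def using c0 by (intro member_le_sum) (auto simp: less_imp_le)
      then have "1 / c (N i) * \<rho> i \<le> d * \<rho> i"
        using nonneg c0 by (intro mult_right_mono) (auto simp: \<rho>_def less_imp_le)
      then show ?thesis using c0[of "N i"] by (simp add: \<rho>_def)
    qed
    moreover have "0 < d" unfolding d_def using c0 by (intro sum_pos) auto
    ultimately show ?thesis by blast
  qed
  moreover have "0 \<le> \<rho> i" for i using nonneg c0 by (simp add: \<rho>_def less_imp_le)
  ultimately show ?thesis using sum by blast
qed

section \<open>Carpet geometry and local summability\<close>

lemma relative_carpetD: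
  assumes "relative_carpet \<Omega> Q"
  shows "open \<Omega>" "open (Q i)" "Q i \<noteq> {}" "closure (Q i) \<subseteq> \<Omega>" "frontier (Q i) \<noteq> {}"
    "frontier (Q i) \<inter> Q j = {}" "frontier (Q i) \<subseteq> carpet \<Omega> Q"
proof -
  have Q: "open_jordan_region (Q i)" "compactly_in (Q i) \<Omega>" for i
    using assms by (auto simp: relative_carpet_def)
  have op: "open (Q i)" for i
    using Q(1)[of i] unfolding open_jordan_region_def
    by (metis closed_simple_path_image open_inside)
  obtain x r where "0 < r" "ball x r \<subseteq> Q i" using assms unfolding relative_carpet_def by blast
  then show ne: "Q i \<noteq> {}" by auto
  show "open \<Omega>" "open (Q i)" "closure (Q i) \<subseteq> \<Omega>"
    using op Q(2) assms by (auto simp: relative_carpet_def compactly_in_def)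
  have "bounded (Q i)"
    using Q(2)[of i] bounded_subset[OF compact_imp_bounded closure_subset]
    by (auto simp: compactly_in_def)
  then have "Q i \<noteq> UNIV" by auto
  then show "frontier (Q i) \<noteq> {}" using ne by (simp add: frontier_eq_empty)
  have dis: "frontier (Q i) \<inter> Q j = {}" for j
  proof (cases "i = j")
    case True
    then show ?thesis using op by (auto simp: frontier_def interior_open)
  next
    case False
    then have "closure (Q i) \<inter> closure (Q j) = {}"
      using assms by (auto simp: relative_carpet_def disjoint_family_on_def)
    then show ?thesis using closure_subset[of "Q j"] by (auto simp: frontier_def)
  qed
  then show "frontier (Q i) \<inter> Q j = {}" .
  have "frontier (Q i) \<subseteq> \<Omega>" using Q(2)[of i] by (auto simp: frontier_def compactly_in_def)
  then show "frontier (Q i) \<subseteq> carpet \<Omega> Q" using dis by (auto simp: carpet_def)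
qed

text \<open>The hypothesis concerns balls, whereas V need not lie in one ball compactly contained in
  \<open>\<Omega>\<close>. The global weight bridges this, as it dominates w up to a constant on the
  disks meeting the closure of V.\<close>

lemma local_square_summable_compact:
  fixes w :: "nat \<Rightarrow> real"
  assumes carpet: "relative_carpet \<Omega> Q" and nonneg: "\<And>i. 0 \<le> w i"
    and loc: "\<And>x r. 0 < r \<Longrightarrow> compactly_in (ball x r) \<Omega> \<Longrightarrow>
      (\<Sum>\<^sub>\<infinity>i\<in>meeting Q (ball x r). ennreal ((w i)\<^sup>2)) < \<infinity>"
    and V: "compactly_in V \<Omega>"
  shows "(\<Sum>\<^sub>\<infinity>i\<in>meeting Q V. ennreal ((w i)\<^sup>2)) < \<infinity>"
proof -
  have Q: "Q i \<subseteq> \<Omega>" for i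
    using relative_carpetD(4)[OF carpet, of i] closure_subset[of "Q i"] by blast
  from weighted_square_summable[OF relative_carpetD(1)[OF carpet] relative_carpetD(3)[OF carpet] Q nonneg loc]
  obtain \<rho> where \<rho>: "(\<Sum>\<^sub>\<infinity>i. ennreal ((\<rho> i)\<^sup>2)) < \<infinity>"
    "\<exists>c>0. \<forall>i\<in>meeting Q (closure V). w i \<le> c * \<rho> i"
    using V unfolding compactly_in_def by blast
  then obtain c where c: "0 < c" "\<And>i. i \<in> meeting Q (closure V) \<Longrightarrow> w i \<le> c * \<rho> i" by blast
  have "(\<Sum>\<^sub>\<infinity>i\<in>meeting Q V. ennreal ((w i)\<^sup>2)) \<le>
      (\<Sum>\<^sub>\<infinity>i\<in>meeting Q V. ennreal (c\<^sup>2) * ennreal ((\<rho> i)\<^sup>2))"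
  proof (rule infsum_ennreal_mono)
    fix i assume "i \<in> meeting Q V"
    then have "w i \<le> c * \<rho> i" using c(2) meeting_mono[OF closure_subset] by blast
    then have "(w i)\<^sup>2 \<le> (c * \<rho> i)\<^sup>2" using nonneg by (intro power_mono)
    then have "ennreal ((w i)\<^sup>2) \<le> ennreal (c\<^sup>2 * (\<rho> i)\<^sup>2)"
      by (intro ennreal_leI) (simp add: power_mult_distrib)
    then show "ennreal ((w i)\<^sup>2) \<le> ennreal (c\<^sup>2) * ennreal ((\<rho> i)\<^sup>2)"
      by (simp add: ennreal_mult)
  qed
  also have "\<dots> \<le> ennreal (c\<^sup>2) * (\<Sum>\<^sub>\<infinity>i. ennreal ((\<rho> i)\<^sup>2))"
    unfolding infsum_ennreal_cmult by (intro mult_left_mono infsum_ennreal_subset) auto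
  also have "\<dots> < \<infinity>" using \<rho>(1) by (simp add: ennreal_mult_less_top)
  finally show ?thesis .
qed

lemma sobolev_loc_osc_finite:
  assumes "sobolev_loc v \<Omega> Q g"
  shows "osc_Q Q g i < \<infinity>"
proof -
  have "\<bar>M_Q Q g i\<bar> \<noteq> \<infinity>" "\<bar>m_Q Q g i\<bar> \<noteq> \<infinity>"
    using assms by (auto simp: sobolev_loc_def)
  then show ?thesis
    unfolding osc_Q_def by (cases "M_Q Q g i"; cases "m_Q Q g i") auto
qed

lemma sobolev_loc_weight:
  assumes carpet: "relative_carpet \<Omega> Q" and g: "sobolev_loc v \<Omega> Q g"
  obtains \<rho> :: "nat \<Rightarrow> real" where "\<And>i. 0 \<le> \<rho> i" "(\<Sum>\<^sub>\<infinity>i. ennreal ((\<rho> i)\<^sup>2)) < \<infinity>"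
    "\<And>K. compact K \<Longrightarrow> K \<subseteq> \<Omega> \<Longrightarrow> \<exists>c>0. \<forall>i\<in>meeting Q K. osc_Q Q g i \<le> ennreal c * ennreal (\<rho> i)"
proof -
  define w where "w i = enn2real (osc_Q Q g i)" for i
  have w: "osc_Q Q g i = ennreal (w i)" "0 \<le> w i" for i
    using sobolev_loc_osc_finite[OF g] by (simp_all add: w_def)
  have Q: "Q i \<subseteq> \<Omega>" for i
    using relative_carpetD(4)[OF carpet, of i] closure_subset[of "Q i"] by blast
  have "(\<Sum>\<^sub>\<infinity>i\<in>meeting Q (ball x r). ennreal ((w i)\<^sup>2)) < \<infinity>"
    if "0 < r" "compactly_in (ball x r) \<Omega>" for x r
    using g that by (simp add: sobolev_loc_def w ennreal_power)
  from weighted_square_summable[OF relative_carpetD(1)[OF carpet] relative_carpetD(3)[OF carpet] Q w(2) this]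
  obtain \<rho> where \<rho>: "\<And>i. 0 \<le> \<rho> i" "(\<Sum>\<^sub>\<infinity>i. ennreal ((\<rho> i)\<^sup>2)) < \<infinity>"
    "\<And>K. compact K \<Longrightarrow> K \<subseteq> \<Omega> \<Longrightarrow> \<exists>c>0. \<forall>i\<in>meeting Q K. w i \<le> c * \<rho> i"
    by blast
  have "\<exists>c>0. \<forall>i\<in>meeting Q K. osc_Q Q g i \<le> ennreal c * ennreal (\<rho> i)"
    if "compact K" "K \<subseteq> \<Omega>" for K
  proof -
    obtain c where c: "0 < c" "\<forall>i\<in>meeting Q K. w i \<le> c * \<rho> i" using \<rho>(3) \<open>compact K\<close> \<open>K \<subseteq> \<Omega>\<close> by blast
    then have "\<forall>i\<in>meeting Q K. osc_Q Q g i \<le> ennreal c * ennreal (\<rho> i)"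
      using \<rho>(1) by (auto simp: w(1) ennreal_mult[symmetric] intro!: ennreal_leI)
    then show ?thesis using c(1) by blast
  qed
  then show ?thesis using that \<rho>(1,2) by blast
qed

text \<open>Finiteness of the sum is gained by discarding the paths on which the global weight
  diverges. It is claimed for compact traces only, because the weight dominates the oscillations
  merely on compact sets.\<close>

lemma sobolev_loc_exceptional:
  fixes f :: "complex \<Rightarrow> real"
  assumes carpet: "relative_carpet \<Omega> Q" and f: "sobolev_loc v \<Omega> Q (\<lambda>x. ereal (f x))"
  shows "\<exists>\<Gamma>. carpet_mod v \<Omega> Q \<Gamma> = 0 \<and> (\<forall>\<gamma>\<in>paths_in \<Omega> - \<Gamma>.
    (compact (path_trace \<gamma>) \<longrightarrow> infsum (osc_Q Q (\<lambda>x. ereal (f x))) (meeting Q (path_trace \<gamma>)) < \<infinity>) \<and>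
    (\<forall>x\<in>path_trace \<gamma> \<inter> carpet \<Omega> Q. \<forall>y\<in>path_trace \<gamma> \<inter> carpet \<Omega> Q.
       ennreal \<bar>f x - f y\<bar> \<le> infsum (osc_Q Q (\<lambda>x. ereal (f x))) (meeting Q (path_trace \<gamma>))))"
proof -
  let ?o = "osc_Q Q (\<lambda>x. ereal (f x))"
  obtain \<Gamma> where \<Gamma>: "carpet_mod v \<Omega> Q \<Gamma> = 0"
    "\<And>\<gamma> x y. \<lbrakk>\<gamma> \<in> paths_in \<Omega> - \<Gamma>; x \<in> path_trace \<gamma> \<inter> carpet \<Omega> Q; y \<in> path_trace \<gamma> \<inter> carpet \<Omega> Q\<rbrakk> \<Longrightarrow>
       \<bar>ereal (f x) - ereal (f y)\<bar> \<le> enn2ereal (infsum ?o (meeting Q (path_trace \<gamma>)))"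
    using f unfolding sobolev_loc_def upper_gradient_def by blast
  obtain \<rho> :: "nat \<Rightarrow> real" where \<rho>: "\<And>i. 0 \<le> \<rho> i" "(\<Sum>\<^sub>\<infinity>i. ennreal ((\<rho> i)\<^sup>2)) < \<infinity>"
    "\<And>K. compact K \<Longrightarrow> K \<subseteq> \<Omega> \<Longrightarrow> \<exists>c>0. \<forall>i\<in>meeting Q K. ?o i \<le> ennreal c * ennreal (\<rho> i)"
    by (rule sobolev_loc_weight[OF carpet f]) blast
  let ?D = "{\<gamma>. (\<Sum>\<^sub>\<infinity>i\<in>meeting Q (path_trace \<gamma>). ennreal (\<rho> i)) = \<infinity>}"
  have "carpet_mod v \<Omega> Q (\<Gamma> \<union> ?D) = 0"
    using \<rho>(1,2) by (intro carpet_mod_Un \<Gamma>(1) carpet_mod_divergent) auto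
  moreover have "infsum ?o (meeting Q (path_trace \<gamma>)) < \<infinity>"
    if \<gamma>: "\<gamma> \<in> paths_in \<Omega> - (\<Gamma> \<union> ?D)" "compact (path_trace \<gamma>)" for \<gamma>
  proof -
    obtain c where c: "0 < c" "\<forall>i\<in>meeting Q (path_trace \<gamma>). ?o i \<le> ennreal c * ennreal (\<rho> i)"
      using \<rho>(3)[of "path_trace \<gamma>"] \<gamma> by (auto simp: paths_in_def)
    have "infsum ?o (meeting Q (path_trace \<gamma>)) \<le>
        ennreal c * (\<Sum>\<^sub>\<infinity>i\<in>meeting Q (path_trace \<gamma>). ennreal (\<rho> i))"
      unfolding infsum_ennreal_cmult[symmetric] using c(2) by (intro infsum_ennreal_mono) auto
    also have "\<dots> < \<infinity>" using \<gamma>(1) by (auto simp: ennreal_mult_less_top less_top)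
    finally show ?thesis .
  qed
  moreover have "ennreal \<bar>f x - f y\<bar> \<le> infsum ?o (meeting Q (path_trace \<gamma>))"
    if "\<gamma> \<in> paths_in \<Omega> - (\<Gamma> \<union> ?D)" "x \<in> path_trace \<gamma> \<inter> carpet \<Omega> Q" "y \<in> path_trace \<gamma> \<inter> carpet \<Omega> Q"
    for \<gamma> x y
  proof -
    have "\<bar>ereal (f x) - ereal (f y)\<bar> \<le> enn2ereal (infsum ?o (meeting Q (path_trace \<gamma>)))"
      using that by (intro \<Gamma>(2)) auto
    then show ?thesis by (simp add: less_eq_ennreal.rep_eq)
  qed
  ultimately show ?thesis by blast
qed

lemma subpath_of_segment:
  assumes \<gamma>: "\<gamma> \<in> paths_in \<Omega>" and st: "s \<in> fst \<gamma>" "t \<in> fst \<gamma>"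
  shows "subpath_of (closed_segment s t, snd \<gamma>) \<gamma>" "(closed_segment s t, snd \<gamma>) \<in> paths_in \<Omega>"
    "compact (path_trace (closed_segment s t, snd \<gamma>))" "continuous_on (closed_segment s t) (snd \<gamma>)"
proof -
  obtain F where int: "is_interval (fst \<gamma>)" and tr: "path_trace \<gamma> \<subseteq> \<Omega>"
    and F: "continuous_on (closure (fst \<gamma>)) F" "\<And>t. t \<in> fst \<gamma> \<Longrightarrow> F t = snd \<gamma> t"
    using \<gamma> by (auto simp: paths_in_def is_cpath_def)
  have sub: "closed_segment s t \<subseteq> fst \<gamma>"
    using int st by (simp add: closed_segment_subset is_interval_convex_1)
  have seg: "is_interval (closed_segment s t)"
    by (simp add: is_interval_convex_1)
  have "continuous_on (closed_segment s t) F"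
    by (rule continuous_on_subset[OF F(1)]) (use sub closure_subset in blast)
  then show cont: "continuous_on (closed_segment s t) (snd \<gamma>)"
    by (rule continuous_on_eq) (use F(2) sub in auto)
  show "subpath_of (closed_segment s t, snd \<gamma>) \<gamma>"
    using seg sub by (simp add: subpath_of_def)
  show "(closed_segment s t, snd \<gamma>) \<in> paths_in \<Omega>"
    using seg sub tr cont compact_imp_bounded[OF compact_segment]
    by (auto simp: paths_in_def is_cpath_def path_trace_def image_subset_iff intro!: exI[of _ "snd \<gamma>"])
  show "compact (path_trace (closed_segment s t, snd \<gamma>))"
    using cont by (simp add: path_trace_def compact_continuous_image)
qed

text \<open>
  Along a fixed path a multiple of the oscillations of \<open>f\<close> and \<open>h\<close> bounds the differences of
  \<open>F\<close>. The multiple depends on the path, but it disappears in \<open>diff_le_sum_osc\<close>.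
\<close>

lemma upper_gradient_locally_lipschitz:
  fixes f h F :: "complex \<Rightarrow> real"
  assumes carpet: "relative_carpet \<Omega> Q"
    and f: "sobolev_loc v \<Omega> Q (\<lambda>x. ereal (f x))" and h: "sobolev_loc v \<Omega> Q (\<lambda>x. ereal (h x))"
    and lip: "\<And>B. \<exists>L\<ge>0. \<forall>x y. \<bar>f x\<bar> \<le> B \<longrightarrow> \<bar>f y\<bar> \<le> B \<longrightarrow> \<bar>h x\<bar> \<le> B \<longrightarrow> \<bar>h y\<bar> \<le> B \<longrightarrow>
      \<bar>F x - F y\<bar> \<le> L * (\<bar>f x - f y\<bar> + \<bar>h x - h y\<bar>)"
  shows "upper_gradient v \<Omega> Q (osc_Q Q (\<lambda>x. ereal (F x))) (\<lambda>x. ereal (F x))"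
proof -
  let ?of = "osc_Q Q (\<lambda>x. ereal (f x))" and ?oh = "osc_Q Q (\<lambda>x. ereal (h x))"
    and ?oF = "osc_Q Q (\<lambda>x. ereal (F x))"
  let ?good = "\<lambda>(g :: complex \<Rightarrow> real) \<gamma>.
    (compact (path_trace \<gamma>) \<longrightarrow> infsum (osc_Q Q (\<lambda>x. ereal (g x))) (meeting Q (path_trace \<gamma>)) < \<infinity>) \<and>
    (\<forall>x\<in>path_trace \<gamma> \<inter> carpet \<Omega> Q. \<forall>y\<in>path_trace \<gamma> \<inter> carpet \<Omega> Q.
       ennreal \<bar>g x - g y\<bar> \<le> infsum (osc_Q Q (\<lambda>x. ereal (g x))) (meeting Q (path_trace \<gamma>)))"
  obtain \<Gamma>f where \<Gamma>f: "carpet_mod v \<Omega> Q \<Gamma>f = 0" "\<forall>\<gamma>\<in>paths_in \<Omega> - \<Gamma>f. ?good f \<gamma>"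
    using sobolev_loc_exceptional[OF carpet f] by auto
  obtain \<Gamma>h where \<Gamma>h: "carpet_mod v \<Omega> Q \<Gamma>h = 0" "\<forall>\<gamma>\<in>paths_in \<Omega> - \<Gamma>h. ?good h \<gamma>"
    using sobolev_loc_exceptional[OF carpet h] by auto
  \<comment> \<open>The pieces of a chain are subpaths, and each of them must be good for f and for
    h.\<close>
  define \<Gamma> where "\<Gamma> = {\<gamma> \<in> paths_in \<Omega>. \<exists>\<gamma>'\<in>\<Gamma>f \<union> \<Gamma>h. subpath_of \<gamma>' \<gamma>}"
  have zero: "carpet_mod v \<Omega> Q \<Gamma> = 0"
    using carpet_mod_Un[OF \<Gamma>f(1) \<Gamma>h(1)] by (rule carpet_mod_superpaths) (auto simp: \<Gamma>_def)
  have main: "ennreal \<bar>F x - F y\<bar> \<le> infsum ?oF (meeting Q (path_trace \<gamma>))"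
    if \<gamma>: "\<gamma> \<in> paths_in \<Omega> - \<Gamma>" and x: "x \<in> path_trace \<gamma> \<inter> carpet \<Omega> Q"
      and y: "y \<in> path_trace \<gamma> \<inter> carpet \<Omega> Q" for \<gamma> x y
  proof -
    obtain s t where st: "s \<in> fst \<gamma>" "t \<in> fst \<gamma>" "x = snd \<gamma> s" "y = snd \<gamma> t"
      using x y by (auto simp: path_trace_def)
    have \<gamma>': "\<gamma> \<in> paths_in \<Omega>" using \<gamma> by blast
    note sub = subpath_of_segment[OF \<gamma>']
    have int: "is_interval (fst \<gamma>)" using \<gamma>' by (simp add: paths_in_def is_cpath_def)
    have segst: "closed_segment s t \<subseteq> fst \<gamma>"
      using int st by (simp add: closed_segment_subset is_interval_convex_1)
    \<comment> \<open>On the segment between the two parameters the trace is compact, so the sums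
      are finite; the whole path may have an open parameter interval.\<close>
    interpret disk_path "snd \<gamma>" "closed_segment s t" Q
      using relative_carpetD[OF carpet] sub(4)[OF st(1,2)]
      by unfold_locales (auto simp: is_interval_convex_1)
    have hit: "hit A = meeting Q (path_trace (A, snd \<gamma>))" for A
      by (simp add: hit_def meeting_def path_trace_def)
    have good: "?good f (closed_segment p q, snd \<gamma>)" "?good h (closed_segment p q, snd \<gamma>)"
      if "p \<in> closed_segment s t" "q \<in> closed_segment s t" for p q
    proof -
      have pq: "p \<in> fst \<gamma>" "q \<in> fst \<gamma>" using that segst by auto
      have "(closed_segment p q, snd \<gamma>) \<notin> \<Gamma>f \<union> \<Gamma>h"
        using \<gamma> sub(1)[OF pq] by (auto simp: \<Gamma>_def)
      then show "?good f (closed_segment p q, snd \<gamma>)" "?good h (closed_segment p q, snd \<gamma>)"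
        using \<Gamma>f(2) \<Gamma>h(2) sub(2)[OF pq] by blast+
    qed
    have in_carpet: "snd \<gamma> p \<in> carpet \<Omega> Q" "p \<in> closed_segment s t" if "free p" for p
      using that \<gamma>' segst by (auto simp: free_def carpet_def paths_in_def path_trace_def image_subset_iff)
    have ug: "ennreal \<bar>f (snd \<gamma> p) - f (snd \<gamma> q)\<bar> \<le> infsum ?of (hit (closed_segment p q))"
      "ennreal \<bar>h (snd \<gamma> p) - h (snd \<gamma> q)\<bar> \<le> infsum ?oh (hit (closed_segment p q))"
      if "free p" "free q" for p q
    proof -
      have "snd \<gamma> p \<in> path_trace (closed_segment p q, snd \<gamma>) \<inter> carpet \<Omega> Q"
        "snd \<gamma> q \<in> path_trace (closed_segment p q, snd \<gamma>) \<inter> carpet \<Omega> Q"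
        using in_carpet that by (auto simp: path_trace_def)
      then show "ennreal \<bar>f (snd \<gamma> p) - f (snd \<gamma> q)\<bar> \<le> infsum ?of (hit (closed_segment p q))"
        "ennreal \<bar>h (snd \<gamma> p) - h (snd \<gamma> q)\<bar> \<le> infsum ?oh (hit (closed_segment p q))"
        using good in_carpet(2) that unfolding hit by blast+
    qed
    have fs: "free s" "free t" using x y st by (auto simp: free_def carpet_def)
    have fin: "infsum ?of (hit (closed_segment s t)) < \<infinity>" "infsum ?oh (hit (closed_segment s t)) < \<infinity>"
      using good[of s t] sub(3)[OF st(1,2)] unfolding hit by simp_all
    obtain Bf where Bf: "infsum ?of (hit (closed_segment s t)) = ennreal Bf" "0 \<le> Bf"
      using fin(1) by (cases "infsum ?of (hit (closed_segment s t))") auto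
    obtain Bh where Bh: "infsum ?oh (hit (closed_segment s t)) = ennreal Bh" "0 \<le> Bh"
      using fin(2) by (cases "infsum ?oh (hit (closed_segment s t))") auto
    \<comment> \<open>Starting from x, neither function can change by more than its total
      oscillation along the segment, so B bounds both at all free parameters.\<close>
    define B where "B = max (\<bar>f x\<bar> + Bf) (\<bar>h x\<bar> + Bh)"
    obtain L where L: "0 \<le> L" "\<And>x y. \<lbrakk>\<bar>f x\<bar> \<le> B; \<bar>f y\<bar> \<le> B; \<bar>h x\<bar> \<le> B; \<bar>h y\<bar> \<le> B\<rbrakk> \<Longrightarrow>
        \<bar>F x - F y\<bar> \<le> L * (\<bar>f x - f y\<bar> + \<bar>h x - h y\<bar>)"
      using lip by meson
    have bound: "\<bar>f (snd \<gamma> p)\<bar> \<le> B" "\<bar>h (snd \<gamma> p)\<bar> \<le> B" if p: "free p" for p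
    proof -
      have seg: "hit (closed_segment s p) \<subseteq> hit (closed_segment s t)"
        using in_carpet(2)[OF p] by (intro hit_mono) (simp add: subset_closed_segment)
      have "ennreal \<bar>f (snd \<gamma> s) - f (snd \<gamma> p)\<bar> \<le> ennreal Bf"
        using order_trans[OF ug(1)[OF fs(1) p] infsum_ennreal_subset[OF seg]] Bf(1) by simp
      then have "\<bar>f x - f (snd \<gamma> p)\<bar> \<le> Bf" using Bf(2) st(3) by (simp add: ennreal_le_iff)
      moreover have "ennreal \<bar>h (snd \<gamma> s) - h (snd \<gamma> p)\<bar> \<le> ennreal Bh"
        using order_trans[OF ug(2)[OF fs(1) p] infsum_ennreal_subset[OF seg]] Bh(1) by simp
      then have "\<bar>h x - h (snd \<gamma> p)\<bar> \<le> Bh" using Bh(2) st(3) by (simp add: ennreal_le_iff)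
      ultimately show "\<bar>f (snd \<gamma> p)\<bar> \<le> B" "\<bar>h (snd \<gamma> p)\<bar> \<le> B"
        unfolding B_def by linarith+
    qed
    let ?\<rho> = "\<lambda>i. ennreal L * (?of i + ?oh i)"
    have "ennreal \<bar>F (snd \<gamma> s) - F (snd \<gamma> t)\<bar> \<le> infsum ?oF (hit (closed_segment s t))"
    proof (rule diff_le_sum_osc[where \<rho> = ?\<rho>, OF fs])
      fix p q assume pq: "free p" "free q"
      have "ennreal \<bar>F (snd \<gamma> p) - F (snd \<gamma> q)\<bar> \<le>
          ennreal (L * (\<bar>f (snd \<gamma> p) - f (snd \<gamma> q)\<bar> + \<bar>h (snd \<gamma> p) - h (snd \<gamma> q)\<bar>))"
        using bound pq by (intro ennreal_leI L(2)) auto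
      also have "\<dots> = ennreal L * (ennreal \<bar>f (snd \<gamma> p) - f (snd \<gamma> q)\<bar> + ennreal \<bar>h (snd \<gamma> p) - h (snd \<gamma> q)\<bar>)"
        using L(1) by (simp add: ennreal_mult ennreal_plus)
      also have "\<dots> \<le> ennreal L * (infsum ?of (hit (closed_segment p q)) + infsum ?oh (hit (closed_segment p q)))"
        using ug pq by (intro mult_left_mono add_mono) auto
      finally show "ennreal \<bar>F (snd \<gamma> p) - F (snd \<gamma> q)\<bar> \<le> infsum ?\<rho> (hit (closed_segment p q))"
        by (simp only: infsum_ennreal_cmult infsum_ennreal_add)
    next
      show "infsum ?\<rho> (hit (closed_segment s t)) < \<infinity>"
        using fin by (simp add: infsum_ennreal_cmult infsum_ennreal_add ennreal_mult_less_top)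
    qed (rule osc_Q_ge)
    also have "\<dots> \<le> infsum ?oF (meeting Q (path_trace \<gamma>))"
      unfolding hit using sub(1)[OF st(1,2)]
      by (intro infsum_ennreal_subset meeting_mono path_trace_subpath)
    finally show ?thesis by (simp only: st)
  qed
  show ?thesis
    unfolding upper_gradient_def
  proof (intro exI[of _ \<Gamma>] conjI ballI)
    show "\<Gamma> \<subseteq> paths_in \<Omega>" by (auto simp: \<Gamma>_def)
    fix \<gamma> x y
    assume "\<gamma> \<in> paths_in \<Omega> - \<Gamma>" "x \<in> path_trace \<gamma> \<inter> carpet \<Omega> Q" "y \<in> path_trace \<gamma> \<inter> carpet \<Omega> Q"
    from main[OF this]
    show "\<bar>ereal (F x) - ereal (F y)\<bar> \<le> enn2ereal (infsum ?oF (meeting Q (path_trace \<gamma>)))"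
      by (simp add: less_eq_ennreal.rep_eq)
  qed (use zero in auto)
qed

section \<open>The competitor\<close>

lemma osc_Q_ereal:
  fixes f :: "complex \<Rightarrow> real"
  assumes "frontier (Q i) \<noteq> {}" "bdd_above (f ` frontier (Q i))" "bdd_below (f ` frontier (Q i))"
  shows "osc_Q Q (\<lambda>x. ereal (f x)) i = ennreal ((SUP x\<in>frontier (Q i). f x) - (INF x\<in>frontier (Q i). f x))"
  using M_Q_ereal[where Q = Q and f = f and i = i] m_Q_ereal[where Q = Q and f = f and i = i] assms by (simp add: osc_Q_def)

text \<open>One-sided differences suffice because the pair is arbitrary; fixing one of the points
  bounds f from both sides, so that the real supremum and infimum are available.\<close>

lemma osc_Q_le:
  fixes f :: "complex \<Rightarrow> real"
  assumes ne: "frontier (Q i) \<noteq> {}"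
    and le: "\<And>x y. x \<in> frontier (Q i) \<Longrightarrow> y \<in> frontier (Q i) \<Longrightarrow> f x - f y \<le> c"
  shows "osc_Q Q (\<lambda>x. ereal (f x)) i \<le> ennreal c"
proof -
  obtain y where y: "y \<in> frontier (Q i)" using ne by blast
  have above: "bdd_above (f ` frontier (Q i))"
    using le[OF _ y] by (intro bdd_aboveI2[of _ _ "f y + c"]) (simp add: algebra_simps)
  have below: "bdd_below (f ` frontier (Q i))"
    using le[OF y] by (intro bdd_belowI2[of _ "f y - c"]) (simp add: algebra_simps)
  have "(SUP x\<in>frontier (Q i). f x) \<le> (INF x\<in>frontier (Q i). f x) + c"
  proof (rule cSUP_least[OF ne])
    fix x assume x: "x \<in> frontier (Q i)"
    have "f x - c \<le> (INF x\<in>frontier (Q i). f x)"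
      using le[OF x] by (intro cINF_greatest[OF ne]) (simp add: algebra_simps)
    then show "f x \<le> (INF x\<in>frontier (Q i). f x) + c" by simp
  qed
  then show ?thesis
    unfolding osc_Q_ereal[where Q = Q and f = f, OF ne above below] by (intro ennreal_leI) simp
qed

lemma M_Q_bounded:
  fixes f :: "complex \<Rightarrow> real"
  assumes ne: "frontier (Q i) \<noteq> {}" and le: "\<And>x. x \<in> frontier (Q i) \<Longrightarrow> \<bar>f x\<bar> \<le> c"
  shows "\<bar>M_Q Q (\<lambda>x. ereal (f x)) i\<bar> \<noteq> \<infinity>" "\<bar>m_Q Q (\<lambda>x. ereal (f x)) i\<bar> \<noteq> \<infinity>"
    "e2ennreal ((M_Q Q (\<lambda>x. ereal (f x)) i)\<^sup>2) \<le> ennreal (c\<^sup>2)"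
proof -
  have f: "f x \<le> c" "- c \<le> f x" if "x \<in> frontier (Q i)" for x
    using le[OF that] by auto
  have above: "bdd_above (f ` frontier (Q i))" and below: "bdd_below (f ` frontier (Q i))"
    using f by (auto intro!: bdd_aboveI2[of _ _ c] bdd_belowI2[of _ "- c"])
  show "\<bar>M_Q Q (\<lambda>x. ereal (f x)) i\<bar> \<noteq> \<infinity>" "\<bar>m_Q Q (\<lambda>x. ereal (f x)) i\<bar> \<noteq> \<infinity>"
    using M_Q_ereal[where Q = Q and f = f, OF ne above] m_Q_ereal[where Q = Q and f = f, OF ne below] by auto
  obtain y where y: "y \<in> frontier (Q i)" using ne by blast
  have "(SUP x\<in>frontier (Q i). f x) \<le> c" using f by (intro cSUP_least[OF ne])
  moreover have "- c \<le> (SUP x\<in>frontier (Q i). f x)"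
    using f(2)[OF y] cSUP_upper[OF y above] by linarith
  ultimately have "(SUP x\<in>frontier (Q i). f x)\<^sup>2 \<le> c\<^sup>2" by (intro abs_le_square_iff[THEN iffD1]) auto
  then show "e2ennreal ((M_Q Q (\<lambda>x. ereal (f x)) i)\<^sup>2) \<le> ennreal (c\<^sup>2)"
    using M_Q_ereal[where Q = Q and f = f, OF ne above] by (simp add: ennreal_leI)
qed

lemma sum_square_le: "(x + y)\<^sup>2 \<le> 2 * x\<^sup>2 + 2 * (y::real)\<^sup>2"
  using sum_squares_bound[of x y] by (simp add: power2_sum)

text \<open>The leading term saves \<open>t^2 a^2\<close>. Half of this pays for the cross term, at
  most 12tak, at the price of 72k^2; the last square adds 36k^2, and 72 + 36 = 108. The other half
  appears on the left.\<close>

lemma competitor_square_le: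
  fixes a k t :: real
  assumes "0 \<le> t" "t \<le> 1" "0 \<le> a" "0 \<le> k"
  shows "((1 - t\<^sup>2) * a + 6 * t * k)\<^sup>2 + (t * a)\<^sup>2 / 2 \<le> a\<^sup>2 + 108 * k\<^sup>2"
proof -
  have t2: "0 \<le> 1 - t\<^sup>2" "1 - t\<^sup>2 \<le> 1" using assms by (auto simp: power_le_one)
  have "((1 - t\<^sup>2) * a + 6 * t * k)\<^sup>2 =
      (1 - t\<^sup>2)\<^sup>2 * a\<^sup>2 + 12 * ((1 - t\<^sup>2) * (t * a * k)) + 36 * (t\<^sup>2 * k\<^sup>2)"
    by algebra
  moreover have "(1 - t\<^sup>2)\<^sup>2 * a\<^sup>2 \<le> (1 - t\<^sup>2) * a\<^sup>2"
    using t2 by (intro mult_right_mono) (auto simp: power2_eq_square mult_left_le)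
  moreover have "(1 - t\<^sup>2) * (t * a * k) \<le> t * a * k"
    using t2 assms by (intro mult_left_le_one_le) auto
  moreover have "t\<^sup>2 * k\<^sup>2 \<le> k\<^sup>2"
    using assms by (intro mult_left_le_one_le) (auto simp: power_le_one)
  moreover have "24 * (t * a * k) \<le> (t * a)\<^sup>2 + 144 * k\<^sup>2"
    using zero_le_power2[of "t * a - 12 * k"] by (simp add: power2_diff power_mult_distrib algebra_simps)
  ultimately show ?thesis by (simp add: algebra_simps power_mult_distrib)
qed

locale cutoff =
  fixes v \<Omega> Q V and \<zeta> u :: "complex \<Rightarrow> real" and N :: real
  assumes carpet: "relative_carpet \<Omega> Q"
    and sobolev_zeta: "sobolev v \<Omega> Q (\<lambda>x. ereal (\<zeta> x))"
    and open_V: "open V" and compact_V: "compactly_in V \<Omega>"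
    and vanish: "\<And>x. x \<in> carpet \<Omega> Q - V \<Longrightarrow> \<zeta> x = 0"
    and nonneg: "\<And>x. x \<in> carpet \<Omega> Q \<Longrightarrow> 0 \<le> \<zeta> x"
    and sobolev_u: "sobolev_loc v \<Omega> Q (\<lambda>x. ereal (u x))"
    and N: "0 < N"
begin

definition "sup_u i = (SUP x\<in>frontier (Q i). u x)"
definition "osc_u i = sup_u i - (INF x\<in>frontier (Q i). u x)"
definition "abs_u i = (SUP x\<in>frontier (Q i). \<bar>u x\<bar>)"
definition "sup_zeta i = (SUP x\<in>frontier (Q i). \<zeta> x)"
definition "osc_zeta i = sup_zeta i - (INF x\<in>frontier (Q i). \<zeta> x)"
text \<open>The supremum over the circle of \<open>min (\<zeta> x) N / N\<close>, since truncation
  at N commutes with suprema of nonempty bounded sets.\<close>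

definition "level i = min (sup_zeta i) N / N"
definition "err i = osc_zeta i * abs_u i / N"
definition "variation x = - ((min (\<zeta> x) N / N)\<^sup>2 * u x)"

section \<open>Estimates on a single peripheral circle\<close>

lemmas ne = relative_carpetD(5)[OF carpet]

lemma frontier_carpet: "x \<in> frontier (Q i) \<Longrightarrow> x \<in> carpet \<Omega> Q"
  using relative_carpetD(7)[OF carpet] by blast

lemma bdd:
  "bdd_above (u ` frontier (Q i))" "bdd_below (u ` frontier (Q i))"
  "bdd_above (\<zeta> ` frontier (Q i))" "bdd_below (\<zeta> ` frontier (Q i))"
  using bounded_M_Q[where Q = Q and f = u and i = i, OF ne]
    bounded_M_Q[where Q = Q and f = \<zeta> and i = i, OF ne] sobolev_u sobolev_zeta
  by (auto simp: sobolev_def sobolev_loc_def)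

lemma bdd_abs_u: "bdd_above ((\<lambda>x. \<bar>u x\<bar>) ` frontier (Q i))"
proof -
  obtain B C where "\<And>x. x \<in> frontier (Q i) \<Longrightarrow> u x \<le> B" "\<And>x. x \<in> frontier (Q i) \<Longrightarrow> C \<le> u x"
    using bdd(1,2) unfolding bdd_above_def bdd_below_def by (metis image_eqI)
  then have "\<bar>u x\<bar> \<le> max B (- C)" if "x \<in> frontier (Q i)" for x using that by fastforce
  then show ?thesis by (intro bdd_aboveI2)
qed

lemma M_Q_eq:
  "M_Q Q (\<lambda>x. ereal (u x)) i = ereal (sup_u i)"
  "M_Q Q (\<lambda>x. ereal \<bar>u x\<bar>) i = ereal (abs_u i)"
  "M_Q Q (\<lambda>x. ereal (\<zeta> x)) i = ereal (sup_zeta i)"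
  "osc_Q Q (\<lambda>x. ereal (u x)) i = ennreal (osc_u i)"
  "osc_Q Q (\<lambda>x. ereal (\<zeta> x)) i = ennreal (osc_zeta i)"
  using M_Q_ereal[where Q = Q and f = u, OF ne bdd(1)] M_Q_ereal[where Q = Q and f = "\<lambda>x. \<bar>u x\<bar>", OF ne bdd_abs_u]
    M_Q_ereal[where Q = Q and f = \<zeta>, OF ne bdd(3)]
    osc_Q_ereal[where Q = Q and f = u, OF ne bdd(1,2)] osc_Q_ereal[where Q = Q and f = \<zeta>, OF ne bdd(3,4)]
  by (simp_all add: sup_u_def abs_u_def sup_zeta_def osc_u_def osc_zeta_def)

lemma pointwise:
  assumes "x \<in> frontier (Q i)"
  shows "u x \<le> sup_u i" "sup_u i - osc_u i \<le> u x" "\<bar>u x\<bar> \<le> abs_u i"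
    "0 \<le> \<zeta> x" "\<zeta> x \<le> sup_zeta i" "sup_zeta i - osc_zeta i \<le> \<zeta> x"
  using assms cSUP_upper[OF assms bdd(1)] cINF_lower[OF bdd(2) assms] cSUP_upper[OF assms bdd_abs_u]
    cSUP_upper[OF assms bdd(3)] cINF_lower[OF bdd(4) assms] nonneg frontier_carpet
  by (auto simp: sup_u_def osc_u_def abs_u_def sup_zeta_def osc_zeta_def)

lemma bounds:
  "0 \<le> osc_u i" "0 \<le> osc_zeta i" "0 \<le> abs_u i" "0 \<le> sup_zeta i" "osc_u i \<le> 2 * abs_u i"
  "abs_u i \<le> \<bar>sup_u i\<bar> + osc_u i" "0 \<le> level i" "level i \<le> 1" "0 \<le> err i"
proof -
  obtain x where x: "x \<in> frontier (Q i)" using ne by blast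
  show 1: "0 \<le> osc_u i" "0 \<le> osc_zeta i" "0 \<le> abs_u i" "0 \<le> sup_zeta i"
    using pointwise[OF x] by linarith+
  have "sup_u i \<le> abs_u i"
    unfolding sup_u_def using pointwise(3) by (intro cSUP_least[OF ne]) fastforce
  moreover have "- abs_u i \<le> (INF x\<in>frontier (Q i). u x)"
    using pointwise(3) by (intro cINF_greatest[OF ne]) fastforce
  ultimately show "osc_u i \<le> 2 * abs_u i" by (simp add: osc_u_def)
  show "abs_u i \<le> \<bar>sup_u i\<bar> + osc_u i"
    unfolding abs_u_def using pointwise(1,2) 1(1) by (intro cSUP_least[OF ne]) fastforce
  show "0 \<le> level i" "level i \<le> 1" "0 \<le> err i"
    using 1 N by (auto simp: level_def err_def)
qed

text \<open>An open V that misses the disk also misses its closure, so the circle lies in the carpet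
  off V. This confines the sums over all disks to \<open>meeting Q V\<close>.\<close>

lemma vanish_disk:
  assumes "i \<notin> meeting Q V"
  shows "x \<in> frontier (Q i) \<Longrightarrow> \<zeta> x = 0" "sup_zeta i = 0" "level i = 0"
proof -
  have "closure (Q i) \<inter> V = {}"
    using assms open_V open_Int_closure_eq_empty[of V "Q i"] by (auto simp: meeting_def)
  then have z: "\<zeta> x = 0" if "x \<in> frontier (Q i)" for x
    using that frontier_carpet[OF that] by (intro vanish) (auto simp: frontier_def)
  then show "x \<in> frontier (Q i) \<Longrightarrow> \<zeta> x = 0" .
  show "sup_zeta i = 0" using z ne[of i] by (simp add: sup_zeta_def)
  then show "level i = 0" using N by (simp add: level_def)
qed

text \<open>
  Replacing \<open>\<zeta> x\<close> by its supremum on the peripheral circle costs a term with the factor \<open>osc_u i\<close>,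
  which \<open>osc_u i \<le> 2 * abs_u i\<close> turns into an error of the same form as the cross term.
\<close>

lemma osc_competitor_le:
  assumes x: "x \<in> frontier (Q i)" and y: "y \<in> frontier (Q i)"
  shows "(u x + variation x) - (u y + variation y) \<le> (1 - (level i)\<^sup>2) * osc_u i + 6 * level i * err i"
    and "variation x - variation y \<le> (level i)\<^sup>2 * osc_u i + 2 * level i * err i"
proof -
  \<comment> \<open>Truncation does not increase oscillation, so d bounds how far p and q fall below
    \<open>level i\<close>.\<close>
  define p q d where "p = min (\<zeta> x) N / N" and "q = min (\<zeta> y) N / N" and "d = osc_zeta i / N"
  have p: "0 \<le> p" "p \<le> level i" "level i - p \<le> d"
    using pointwise(4-6)[OF x] bounds(2)[of i] N
    by (auto simp: p_def level_def d_def divide_right_mono diff_divide_distrib[symmetric])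
  have q: "0 \<le> q" "q \<le> level i" "level i - q \<le> d"
    using pointwise(4-6)[OF y] bounds(2)[of i] N
    by (auto simp: q_def level_def d_def divide_right_mono diff_divide_distrib[symmetric])
  have sq: "(level i)\<^sup>2 - r\<^sup>2 \<le> 2 * level i * d" if "0 \<le> r" "r \<le> level i" "level i - r \<le> d" for r
  proof -
    have "(level i)\<^sup>2 - r\<^sup>2 = (level i + r) * (level i - r)" by algebra
    also have "\<dots> \<le> (2 * level i) * d" using that by (intro mult_mono) auto
    finally show ?thesis .
  qed
  have le: "p\<^sup>2 \<le> (level i)\<^sup>2" "q\<^sup>2 \<le> (level i)\<^sup>2" using p q by (auto intro: power_mono)
  have pq: "\<bar>q\<^sup>2 - p\<^sup>2\<bar> \<le> 2 * level i * d" using sq[OF p] sq[OF q] le by (auto simp: abs_le_iff)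
  have d: "0 \<le> level i * d" using p(1,2) bounds(2)[of i] N by (auto simp: d_def)
  have err: "err i = d * abs_u i" by (simp add: err_def d_def)
  have u: "\<bar>u x - u y\<bar> \<le> osc_u i" using pointwise(1,2)[OF x] pointwise(1,2)[OF y] by auto
  have uy: "\<bar>u y\<bar> \<le> abs_u i" using pointwise(3)[OF y] .
  have cross: "\<bar>(q\<^sup>2 - p\<^sup>2) * u y\<bar> \<le> 2 * level i * err i"
    using mult_mono[OF pq uy] d by (simp add: abs_mult err mult_ac)
  have v: "variation x = - (p\<^sup>2 * u x)" "variation y = - (q\<^sup>2 * u y)"
    by (simp_all add: variation_def p_def q_def)
  \<comment> \<open>The coefficient 6 is 2 + 4: the last product contributes 2, and replacing
    \<open>p\<close> by \<open>level i\<close> in the first contributes 2 * 2.\<close>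
  have "(u x + variation x) - (u y + variation y) = (1 - p\<^sup>2) * (u x - u y) + (q\<^sup>2 - p\<^sup>2) * u y"
    unfolding v by algebra
  also have "(1 - p\<^sup>2) * (u x - u y) \<le> (1 - p\<^sup>2) * osc_u i"
    using u p bounds(8)[of i] by (intro mult_left_mono) (auto simp: power_le_one)
  also have "(1 - p\<^sup>2) * osc_u i = (1 - (level i)\<^sup>2) * osc_u i + ((level i)\<^sup>2 - p\<^sup>2) * osc_u i"
    by algebra
  also have "((level i)\<^sup>2 - p\<^sup>2) * osc_u i \<le> (2 * level i * d) * (2 * abs_u i)"
    using sq[OF p] bounds(1,5)[of i] d by (intro mult_mono) (auto simp: mult.commute)
  finally show "(u x + variation x) - (u y + variation y) \<le> (1 - (level i)\<^sup>2) * osc_u i + 6 * level i * err i"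
    using cross by (simp add: err algebra_simps abs_le_iff)
  \<comment> \<open>Here the leading factor increases with \<open>p\<close>, so passing to
    \<open>level i\<close> costs nothing and only the coefficient 2 remains.\<close>
  have "variation x - variation y = p\<^sup>2 * (u y - u x) + (q\<^sup>2 - p\<^sup>2) * u y"
    unfolding v by algebra
  also have "p\<^sup>2 * (u y - u x) \<le> (level i)\<^sup>2 * osc_u i"
    using u le bounds(1)[of i] by (intro order_trans[OF mult_left_mono mult_right_mono]) auto
  finally show "variation x - variation y \<le> (level i)\<^sup>2 * osc_u i + 2 * level i * err i"
    using cross by (simp add: abs_le_iff)
qed

lemma variation_le:
  assumes x: "x \<in> frontier (Q i)"
  shows "\<bar>variation x\<bar> \<le> (level i)\<^sup>2 * abs_u i"
proof -
  have "(min (\<zeta> x) N / N)\<^sup>2 \<le> (level i)\<^sup>2"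
    using pointwise(4,5)[OF x] N by (intro power_mono) (auto simp: level_def divide_right_mono)
  then show ?thesis
    using pointwise(3)[OF x] bounds(3)[of i]
    unfolding variation_def abs_minus_cancel abs_mult abs_power2 by (intro mult_mono) auto
qed

section \<open>Sobolev membership of the variation\<close>

lemma osc_u_square_summable: "(\<Sum>\<^sub>\<infinity>i\<in>meeting Q V. ennreal ((osc_u i)\<^sup>2)) < \<infinity>"
  using sobolev_u bounds(1)
  by (intro local_square_summable_compact[OF carpet _ _ compact_V])
     (auto simp: sobolev_loc_def M_Q_eq ennreal_power)

lemma sup_u_square_summable: "(\<Sum>\<^sub>\<infinity>i\<in>meeting Q V. ennreal ((\<bar>sup_u i\<bar> * diameter (Q i))\<^sup>2)) < \<infinity>"
proof (rule local_square_summable_compact[OF carpet _ _ compact_V])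
  have "bounded (Q i)" for i
    using carpet bounded_subset[OF compact_imp_bounded closure_subset]
    by (auto simp: relative_carpet_def compactly_in_def)
  then show "0 \<le> \<bar>sup_u i\<bar> * diameter (Q i)" for i by (simp add: diameter_ge_0)
  show "(\<Sum>\<^sub>\<infinity>i\<in>meeting Q (ball x r). ennreal ((\<bar>sup_u i\<bar> * diameter (Q i))\<^sup>2)) < \<infinity>"
    if "0 < r" "compactly_in (ball x r) \<Omega>" for x r
    using sobolev_u that by (simp add: sobolev_loc_def M_Q_eq power_mult_distrib ennreal_mult)
qed

text \<open>Each term of a convergent sum is bounded by the total. This controls
  \<open>level i * diameter (Q i)\<close> without a separate bound on the diameters.\<close>

lemma sup_zeta_diameter_bounded: "\<exists>C. \<forall>i. (sup_zeta i * diameter (Q i))\<^sup>2 \<le> C"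
proof -
  have "(\<Sum>\<^sub>\<infinity>i. ennreal ((sup_zeta i * diameter (Q i))\<^sup>2)) < \<infinity>"
    using sobolev_zeta by (simp add: sobolev_def M_Q_eq power_mult_distrib ennreal_mult)
  then obtain C where C: "0 \<le> C" "(\<Sum>\<^sub>\<infinity>i. ennreal ((sup_zeta i * diameter (Q i))\<^sup>2)) = ennreal C"
    by (cases "\<Sum>\<^sub>\<infinity>i. ennreal ((sup_zeta i * diameter (Q i))\<^sup>2)") auto
  have "ennreal ((sup_zeta i * diameter (Q i))\<^sup>2) \<le> ennreal C" for i
    unfolding C(2)[symmetric]
    using sum_le_infsum_ennreal[of "{i}" UNIV "\<lambda>i. ennreal ((sup_zeta i * diameter (Q i))\<^sup>2)"] by simp
  then show ?thesis using C(1) by (auto simp: ennreal_le_iff)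
qed

lemma upper_gradient_variation:
  "upper_gradient v \<Omega> Q (osc_Q Q (\<lambda>x. ereal (variation x))) (\<lambda>x. ereal (variation x))"
proof (rule upper_gradient_locally_lipschitz[OF carpet sobolev_u])
  show "sobolev_loc v \<Omega> Q (\<lambda>x. ereal (\<zeta> x))" using sobolev_zeta by (simp add: sobolev_def)
  fix B :: real
  \<comment> \<open>A bound for the truncated quotient in absolute value: x and y range over the
    plane, and off the carpet \<open>\<zeta>\<close> may be negative.\<close>
  define A where "A = (\<bar>B\<bar> + N) / N"
  have A: "0 \<le> A" using N by (simp add: A_def)
  define L where "L = A\<^sup>2 + 2 * A * \<bar>B\<bar> / N"
  have "\<bar>variation x - variation y\<bar> \<le> L * (\<bar>u x - u y\<bar> + \<bar>\<zeta> x - \<zeta> y\<bar>)"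
    if "\<bar>u x\<bar> \<le> B" "\<bar>u y\<bar> \<le> B" "\<bar>\<zeta> x\<bar> \<le> B" "\<bar>\<zeta> y\<bar> \<le> B" for x y
  proof -
    define p q where "p = min (\<zeta> x) N / N" and "q = min (\<zeta> y) N / N"
    have pq: "\<bar>p\<bar> \<le> A" "\<bar>q\<bar> \<le> A"
      using that N by (auto simp: p_def q_def A_def abs_divide min_def intro!: divide_right_mono)
    have "\<bar>p - q\<bar> = \<bar>min (\<zeta> x) N - min (\<zeta> y) N\<bar> / N"
      using N by (simp add: p_def q_def diff_divide_distrib[symmetric])
    also have "\<dots> \<le> \<bar>\<zeta> x - \<zeta> y\<bar> / N" using N by (intro divide_right_mono) auto
    finally have diff: "\<bar>p - q\<bar> \<le> \<bar>\<zeta> x - \<zeta> y\<bar> / N" .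
    have "\<bar>q\<^sup>2 - p\<^sup>2\<bar> = \<bar>p + q\<bar> * \<bar>p - q\<bar>"
      by (simp add: abs_mult[symmetric] power2_eq_square algebra_simps abs_minus_commute)
    also have "\<dots> \<le> (2 * A) * (\<bar>\<zeta> x - \<zeta> y\<bar> / N)" using pq diff by (intro mult_mono) auto
    finally have sq: "\<bar>q\<^sup>2 - p\<^sup>2\<bar> \<le> 2 * A * (\<bar>\<zeta> x - \<zeta> y\<bar> / N)" by simp
    have p2: "p\<^sup>2 \<le> A\<^sup>2" using pq(1) A by (intro abs_le_square_iff[THEN iffD1]) auto
    have "\<bar>variation x - variation y\<bar> = \<bar>p\<^sup>2 * (u y - u x) + (q\<^sup>2 - p\<^sup>2) * u y\<bar>"
      by (simp add: variation_def p_def q_def algebra_simps)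
    also have "\<dots> \<le> p\<^sup>2 * \<bar>u x - u y\<bar> + \<bar>q\<^sup>2 - p\<^sup>2\<bar> * \<bar>u y\<bar>"
      by (rule order_trans[OF abs_triangle_ineq]) (simp add: abs_mult abs_minus_commute)
    also have "\<dots> \<le> A\<^sup>2 * \<bar>u x - u y\<bar> + (2 * A * (\<bar>\<zeta> x - \<zeta> y\<bar> / N)) * \<bar>B\<bar>"
      using p2 sq that(2) A N by (intro add_mono mult_mono mult_right_mono) auto
    also have "\<dots> \<le> L * \<bar>u x - u y\<bar> + L * \<bar>\<zeta> x - \<zeta> y\<bar>"
    proof (rule add_mono)
      show "A\<^sup>2 * \<bar>u x - u y\<bar> \<le> L * \<bar>u x - u y\<bar>"
        using A N by (intro mult_right_mono) (auto simp: L_def)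
      have "2 * A * \<bar>B\<bar> / N * \<bar>\<zeta> x - \<zeta> y\<bar> \<le> L * \<bar>\<zeta> x - \<zeta> y\<bar>"
        by (intro mult_right_mono) (auto simp: L_def)
      then show "2 * A * (\<bar>\<zeta> x - \<zeta> y\<bar> / N) * \<bar>B\<bar> \<le> L * \<bar>\<zeta> x - \<zeta> y\<bar>"
        by (simp add: algebra_simps)
    qed
    finally show ?thesis by (simp add: distrib_left)
  qed
  moreover have "0 \<le> L" using A N by (simp add: L_def)
  ultimately show "\<exists>L\<ge>0. \<forall>x y. \<bar>u x\<bar> \<le> B \<longrightarrow> \<bar>u y\<bar> \<le> B \<longrightarrow> \<bar>\<zeta> x\<bar> \<le> B \<longrightarrow> \<bar>\<zeta> y\<bar> \<le> B \<longrightarrow>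
      \<bar>variation x - variation y\<bar> \<le> L * (\<bar>u x - u y\<bar> + \<bar>\<zeta> x - \<zeta> y\<bar>)"
    by blast
qed

definition "rhs = (\<Sum>\<^sub>\<infinity>i. ennreal ((osc_zeta i * abs_u i)\<^sup>2))"

lemma err_square_sum: "(\<Sum>\<^sub>\<infinity>i\<in>A. ennreal ((err i)\<^sup>2)) \<le> ennreal (1 / N\<^sup>2) * rhs"
proof -
  have "(err i)\<^sup>2 = 1 / N\<^sup>2 * (osc_zeta i * abs_u i)\<^sup>2" for i
    by (simp add: err_def power_divide)
  then have "(\<Sum>\<^sub>\<infinity>i\<in>A. ennreal ((err i)\<^sup>2)) = ennreal (1 / N\<^sup>2) * (\<Sum>\<^sub>\<infinity>i\<in>A. ennreal ((osc_zeta i * abs_u i)\<^sup>2))"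
    by (simp add: ennreal_mult infsum_ennreal_cmult del: times_divide_eq_left)
  also have "\<dots> \<le> ennreal (1 / N\<^sup>2) * rhs"
    unfolding rhs_def by (intro mult_left_mono infsum_ennreal_subset) auto
  finally show ?thesis .
qed

lemma infsum_vanishing:
  fixes f g :: "nat \<Rightarrow> ennreal"
  assumes "\<And>i. i \<notin> meeting Q V \<Longrightarrow> f i = 0" "\<And>i. i \<in> meeting Q V \<Longrightarrow> f i \<le> g i"
  shows "infsum f UNIV \<le> infsum g (meeting Q V)"
  using assms by (intro infsum_mono_neutral nonneg_summable_on_complete) auto

text \<open>Finiteness of \<open>rhs\<close> is used for the oscillations, through the squares of
  \<open>err\<close>. The sum with diameters is controlled by the local data of u and the bound on
  \<open>sup_zeta i * diameter (Q i)\<close>.\<close>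

lemma sobolev_variation:
  assumes fin: "rhs < \<infinity>"
  shows "sobolev v \<Omega> Q (\<lambda>x. ereal (variation x))"
proof -
  let ?g = "\<lambda>x. ereal (variation x)"
  note bounded = M_Q_bounded[where f = variation and Q = Q, OF ne variation_le]
  have finite: "\<bar>M_Q Q ?g i\<bar> \<noteq> \<infinity>" "\<bar>m_Q Q ?g i\<bar> \<noteq> \<infinity>"
    and sup_le: "e2ennreal ((M_Q Q ?g i)\<^sup>2) \<le> ennreal (((level i)\<^sup>2 * abs_u i)\<^sup>2)" for i
    by (rule bounded, assumption)+
  obtain C where C: "\<And>i. (sup_zeta i * diameter (Q i))\<^sup>2 \<le> C"
    using sup_zeta_diameter_bounded by blast
  have C0: "0 \<le> C" using C[of 0] zero_le_power2 order_trans by blast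
  have sup: "(\<Sum>\<^sub>\<infinity>i. e2ennreal ((M_Q Q ?g i)\<^sup>2) * ennreal ((diameter (Q i))\<^sup>2)) < \<infinity>"
  proof -
    have "(\<Sum>\<^sub>\<infinity>i. e2ennreal ((M_Q Q ?g i)\<^sup>2) * ennreal ((diameter (Q i))\<^sup>2)) \<le>
        (\<Sum>\<^sub>\<infinity>i\<in>meeting Q V. ennreal 2 * ennreal ((\<bar>sup_u i\<bar> * diameter (Q i))\<^sup>2) +
           ennreal (2 * C / N\<^sup>2) * ennreal ((osc_u i)\<^sup>2))"
    proof (rule infsum_vanishing)
      fix i assume "i \<notin> meeting Q V"
      then have "e2ennreal ((M_Q Q ?g i)\<^sup>2) \<le> 0"
        using sup_le[of i] by (simp add: vanish_disk(3))
      then show "e2ennreal ((M_Q Q ?g i)\<^sup>2) * ennreal ((diameter (Q i))\<^sup>2) = 0" by simp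
    next
      fix i assume "i \<in> meeting Q V"
      let ?d = "diameter (Q i)"
      have "((level i)\<^sup>2 * abs_u i)\<^sup>2 * ?d\<^sup>2 = (level i)\<^sup>2 * ((level i)\<^sup>2 * (abs_u i)\<^sup>2 * ?d\<^sup>2)"
        by algebra
      also have "\<dots> \<le> (level i)\<^sup>2 * (abs_u i)\<^sup>2 * ?d\<^sup>2"
        using bounds(7,8)[of i] by (intro mult_left_le_one_le) (auto simp: power_le_one)
      \<comment> \<open>The Sobolev condition controls the supremum of u, not of its absolute value;
        the difference is paid by \<open>osc_u i\<close>.\<close>
      also have "\<dots> \<le> (level i)\<^sup>2 * (2 * \<bar>sup_u i\<bar>\<^sup>2 + 2 * (osc_u i)\<^sup>2) * ?d\<^sup>2"
        using order_trans[OF power_mono[OF bounds(6,3)[of i]] sum_square_le]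
        by (intro mult_right_mono mult_left_mono) auto
      also have "\<dots> = (level i)\<^sup>2 * (2 * (\<bar>sup_u i\<bar> * ?d)\<^sup>2) + 2 * (level i * ?d)\<^sup>2 * (osc_u i)\<^sup>2"
        by algebra
      also have "\<dots> \<le> 2 * (\<bar>sup_u i\<bar> * ?d)\<^sup>2 + 2 * (C / N\<^sup>2) * (osc_u i)\<^sup>2"
      proof (intro add_mono mult_right_mono mult_left_mono)
        show "(level i)\<^sup>2 * (2 * (\<bar>sup_u i\<bar> * ?d)\<^sup>2) \<le> 2 * (\<bar>sup_u i\<bar> * ?d)\<^sup>2"
          using bounds(7,8)[of i] by (intro mult_left_le_one_le) (auto simp: power_le_one)
        have "(level i)\<^sup>2 \<le> (sup_zeta i / N)\<^sup>2"
          using bounds(7)[of i] N by (intro power_mono) (auto simp: level_def divide_right_mono)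
        then have "(level i * ?d)\<^sup>2 \<le> (sup_zeta i * ?d)\<^sup>2 / N\<^sup>2"
          using mult_right_mono[of "(level i)\<^sup>2" "(sup_zeta i / N)\<^sup>2" "?d\<^sup>2"] by (simp add: power_mult_distrib power_divide)
        also have "\<dots> \<le> C / N\<^sup>2" using C by (intro divide_right_mono) auto
        finally show "(level i * ?d)\<^sup>2 \<le> C / N\<^sup>2" .
      qed auto
      finally have le: "((level i)\<^sup>2 * abs_u i)\<^sup>2 * ?d\<^sup>2 \<le> 2 * (\<bar>sup_u i\<bar> * ?d)\<^sup>2 + 2 * C / N\<^sup>2 * (osc_u i)\<^sup>2"
        by simp
      have "e2ennreal ((M_Q Q ?g i)\<^sup>2) * ennreal (?d\<^sup>2) \<le> ennreal (((level i)\<^sup>2 * abs_u i)\<^sup>2) * ennreal (?d\<^sup>2)"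
        by (intro mult_right_mono sup_le) simp
      also have "\<dots> = ennreal (((level i)\<^sup>2 * abs_u i)\<^sup>2 * ?d\<^sup>2)"
        by (rule ennreal_mult[symmetric]) simp_all
      also have "\<dots> \<le> ennreal (2 * (\<bar>sup_u i\<bar> * ?d)\<^sup>2 + 2 * C / N\<^sup>2 * (osc_u i)\<^sup>2)"
        by (rule ennreal_leI[OF le])
      also have "\<dots> = ennreal 2 * ennreal ((\<bar>sup_u i\<bar> * ?d)\<^sup>2) + ennreal (2 * C / N\<^sup>2) * ennreal ((osc_u i)\<^sup>2)"
        using C0 by (simp only: ennreal_plus ennreal_mult zero_le_power2 zero_le_numeral
            mult_nonneg_nonneg divide_nonneg_nonneg)
      finally show "e2ennreal ((M_Q Q ?g i)\<^sup>2) * ennreal (?d\<^sup>2) \<le>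
        ennreal 2 * ennreal ((\<bar>sup_u i\<bar> * ?d)\<^sup>2) + ennreal (2 * C / N\<^sup>2) * ennreal ((osc_u i)\<^sup>2)" .
    qed
    also have "\<dots> < \<infinity>"
      using sup_u_square_summable osc_u_square_summable
      by (simp add: infsum_ennreal_add infsum_ennreal_cmult ennreal_mult_less_top)
    finally show ?thesis .
  qed
  have osc: "(\<Sum>\<^sub>\<infinity>i. (osc_Q Q ?g i)\<^sup>2) < \<infinity>"
  proof -
    have osc_le: "osc_Q Q ?g i \<le> ennreal ((level i)\<^sup>2 * osc_u i + 2 * level i * err i)" for i
      by (rule osc_Q_le[OF ne osc_competitor_le(2)])
    have "(\<Sum>\<^sub>\<infinity>i. (osc_Q Q ?g i)\<^sup>2) \<le>
        (\<Sum>\<^sub>\<infinity>i\<in>meeting Q V. ennreal 2 * ennreal ((osc_u i)\<^sup>2) + ennreal 8 * ennreal ((err i)\<^sup>2))"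
    proof (rule infsum_vanishing)
      fix i assume "i \<notin> meeting Q V"
      then show "(osc_Q Q ?g i)\<^sup>2 = 0" using osc_le[of i] by (simp add: vanish_disk(3))
    next
      fix i
      have "(level i)\<^sup>2 * osc_u i \<le> osc_u i" "level i * err i \<le> err i"
        using bounds[of i] by (intro mult_left_le_one_le; simp add: power_le_one)+
      then have "((level i)\<^sup>2 * osc_u i + 2 * level i * err i)\<^sup>2 \<le> (osc_u i + 2 * err i)\<^sup>2"
        using bounds[of i] by (intro power_mono) auto
      also have "\<dots> \<le> 2 * (osc_u i)\<^sup>2 + 8 * (err i)\<^sup>2"
        using sum_square_le[of "osc_u i" "2 * err i"] by (simp add: power_mult_distrib)
      finally have le: "((level i)\<^sup>2 * osc_u i + 2 * level i * err i)\<^sup>2 \<le> 2 * (osc_u i)\<^sup>2 + 8 * (err i)\<^sup>2" .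
      have "(osc_Q Q ?g i)\<^sup>2 \<le> (ennreal ((level i)\<^sup>2 * osc_u i + 2 * level i * err i))\<^sup>2"
        by (intro power_mono osc_le) simp
      also have "\<dots> = ennreal (((level i)\<^sup>2 * osc_u i + 2 * level i * err i)\<^sup>2)"
        using bounds[of i] by (intro ennreal_power) auto
      also have "\<dots> \<le> ennreal (2 * (osc_u i)\<^sup>2 + 8 * (err i)\<^sup>2)" by (rule ennreal_leI[OF le])
      also have "\<dots> = ennreal 2 * ennreal ((osc_u i)\<^sup>2) + ennreal 8 * ennreal ((err i)\<^sup>2)"
        by (simp only: ennreal_plus ennreal_mult zero_le_power2 zero_le_numeral mult_nonneg_nonneg)
      finally show "(osc_Q Q ?g i)\<^sup>2 \<le> ennreal 2 * ennreal ((osc_u i)\<^sup>2) + ennreal 8 * ennreal ((err i)\<^sup>2)" .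
    qed
    also have "\<dots> < \<infinity>"
      using osc_u_square_summable le_less_trans[OF err_square_sum[of "meeting Q V"]] fin
      by (simp add: infsum_ennreal_add infsum_ennreal_cmult ennreal_mult_less_top)
    finally show ?thesis .
  qed
  have "sobolev_loc v \<Omega> Q ?g"
    unfolding sobolev_loc_def
    by (intro conjI allI impI finite upper_gradient_variation
        le_less_trans[OF infsum_ennreal_subset[OF subset_UNIV] sup]
        le_less_trans[OF infsum_ennreal_subset[OF subset_UNIV] osc])
  then show ?thesis unfolding sobolev_def using sup osc by blast
qed

section \<open>Comparison of energies\<close>

lemma truncated_inequality:
  assumes harmonic: "carpet_harmonic v \<Omega> Q (\<lambda>x. ereal (u x))" and fin: "rhs < \<infinity>"
  shows "(\<Sum>\<^sub>\<infinity>i. ennreal ((min (sup_zeta i) N * osc_u i)\<^sup>2)) \<le> ennreal 216 * rhs"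
proof -
  let ?I = "meeting Q V"
  let ?w = "\<lambda>x. ereal (u x + variation x)"
  let ?D = "\<Sum>\<^sub>\<infinity>i\<in>?I. ennreal ((osc_u i)\<^sup>2)"
  let ?S = "\<Sum>\<^sub>\<infinity>i\<in>?I. ennreal ((level i * osc_u i)\<^sup>2 / 2)"
  have "variation x = 0" if "x \<in> carpet \<Omega> Q - V" for x
    using vanish[OF that] N by (simp add: variation_def)
  then have "dirichlet_energy Q V (\<lambda>x. ereal (u x)) \<le> dirichlet_energy Q V (\<lambda>x. ereal (u x) + ereal (variation x))"
    using harmonic[unfolded carpet_harmonic_def, THEN conjunct2, rule_format, of V "\<lambda>x. ereal (variation x)"]
      open_V compact_V sobolev_variation[OF fin] by simp
  then have min: "?D \<le> (\<Sum>\<^sub>\<infinity>i\<in>?I. (osc_Q Q ?w i)\<^sup>2)"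
    using bounds(1) by (simp add: dirichlet_energy_def M_Q_eq ennreal_power)
  have disk: "(osc_Q Q ?w i)\<^sup>2 + ennreal ((level i * osc_u i)\<^sup>2 / 2) \<le>
      ennreal ((osc_u i)\<^sup>2) + ennreal 108 * ennreal ((err i)\<^sup>2)" for i
  proof -
    let ?c = "(1 - (level i)\<^sup>2) * osc_u i + 6 * level i * err i"
    have c: "0 \<le> ?c"
      using bounds[of i] by (intro add_nonneg_nonneg mult_nonneg_nonneg) (auto simp: power_le_one)
    have "(osc_Q Q ?w i)\<^sup>2 \<le> (ennreal ?c)\<^sup>2"
      by (intro power_mono osc_Q_le[OF ne osc_competitor_le(1)]) auto
    also have "\<dots> = ennreal (?c\<^sup>2)" using c by (rule ennreal_power)
    finally have "(osc_Q Q ?w i)\<^sup>2 + ennreal ((level i * osc_u i)\<^sup>2 / 2) \<le>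
        ennreal (?c\<^sup>2) + ennreal ((level i * osc_u i)\<^sup>2 / 2)"
      by (rule add_right_mono)
    also have "\<dots> = ennreal (?c\<^sup>2 + (level i * osc_u i)\<^sup>2 / 2)" by (simp add: ennreal_plus)
    also have "\<dots> \<le> ennreal ((osc_u i)\<^sup>2 + 108 * (err i)\<^sup>2)"
      using bounds[of i] by (intro ennreal_leI competitor_square_le) auto
    also have "\<dots> = ennreal ((osc_u i)\<^sup>2) + ennreal 108 * ennreal ((err i)\<^sup>2)"
      by (simp only: ennreal_plus ennreal_mult zero_le_power2 zero_le_numeral mult_nonneg_nonneg)
    finally show ?thesis .
  qed
  have "?D + ?S \<le> (\<Sum>\<^sub>\<infinity>i\<in>?I. (osc_Q Q ?w i)\<^sup>2) + ?S" by (intro add_right_mono min)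
  also have "\<dots> = (\<Sum>\<^sub>\<infinity>i\<in>?I. (osc_Q Q ?w i)\<^sup>2 + ennreal ((level i * osc_u i)\<^sup>2 / 2))"
    by (rule infsum_ennreal_add[symmetric])
  also have "\<dots> \<le> (\<Sum>\<^sub>\<infinity>i\<in>?I. ennreal ((osc_u i)\<^sup>2) + ennreal 108 * ennreal ((err i)\<^sup>2))"
    by (intro infsum_ennreal_mono disk)
  also have "\<dots> = ?D + ennreal 108 * (\<Sum>\<^sub>\<infinity>i\<in>?I. ennreal ((err i)\<^sup>2))"
    by (simp only: infsum_ennreal_add infsum_ennreal_cmult)
  \<comment> \<open>Cancelling \<open>?D\<close> in the extended reals is legitimate because it is
    finite.\<close>
  finally have "?S \<le> ennreal 108 * (\<Sum>\<^sub>\<infinity>i\<in>?I. ennreal ((err i)\<^sup>2))"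
    using osc_u_square_summable by (auto simp: ennreal_add_left_cancel_le)
  also have "\<dots> \<le> ennreal 108 * (ennreal (1 / N\<^sup>2) * rhs)"
    by (intro mult_left_mono err_square_sum) simp
  finally have S: "?S \<le> ennreal 108 * (ennreal (1 / N\<^sup>2) * rhs)" .
  have "(\<Sum>\<^sub>\<infinity>i. ennreal ((min (sup_zeta i) N * osc_u i)\<^sup>2)) \<le>
      (\<Sum>\<^sub>\<infinity>i\<in>?I. ennreal (2 * N\<^sup>2) * ennreal ((level i * osc_u i)\<^sup>2 / 2))"
  proof (rule infsum_vanishing)
    fix i assume "i \<notin> ?I"
    then show "ennreal ((min (sup_zeta i) N * osc_u i)\<^sup>2) = 0" using N by (simp add: vanish_disk(2))
  next
    fix i
    have "(min (sup_zeta i) N * osc_u i)\<^sup>2 = 2 * N\<^sup>2 * ((level i * osc_u i)\<^sup>2 / 2)"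
      using N by (simp add: level_def power_mult_distrib power_divide)
    then show "ennreal ((min (sup_zeta i) N * osc_u i)\<^sup>2) \<le> ennreal (2 * N\<^sup>2) * ennreal ((level i * osc_u i)\<^sup>2 / 2)"
      by (simp add: ennreal_mult[symmetric])
  qed
  also have "\<dots> = ennreal (2 * N\<^sup>2) * ?S" by (rule infsum_ennreal_cmult)
  also have "\<dots> \<le> ennreal (2 * N\<^sup>2) * (ennreal 108 * (ennreal (1 / N\<^sup>2) * rhs))"
    by (intro mult_left_mono S) simp
  also have "\<dots> = ennreal (2 * N\<^sup>2 * 108 * (1 / N\<^sup>2)) * rhs"
    by (simp only: ennreal_mult zero_le_power2 zero_le_numeral zero_le_one mult_nonneg_nonneg
        divide_nonneg_nonneg mult.assoc)
  \<comment> \<open>The power of N from \<open>level\<close> cancels the one from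
    \<open>err\<close>, and the 2 undoes the half in \<open>?S\<close>.\<close>
  also have "2 * N\<^sup>2 * 108 * (1 / N\<^sup>2) = 216" using N by simp
  finally show ?thesis .
qed

end

section \<open>Removal of the truncation\<close>

theorem theorem2p73:
  shows "\<exists>C>0. \<forall>(v :: version) (\<Omega> :: complex set) (Q :: nat \<Rightarrow> complex set)
            (\<zeta> :: complex \<Rightarrow> real) (u :: complex \<Rightarrow> real).
     relative_carpet \<Omega> Q \<longrightarrow>
     test_function v \<Omega> Q (\<lambda>x. ereal (\<zeta> x)) \<longrightarrow>
     (\<forall>x\<in>carpet \<Omega> Q. \<zeta> x \<ge> 0) \<longrightarrow>
     carpet_harmonic v \<Omega> Q (\<lambda>x. ereal (u x)) \<longrightarrow>
     normalized v \<Omega> Q (\<lambda>x. ereal (u x)) \<longrightarrow>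
     (\<Sum>\<^sub>\<infinity>i. e2ennreal ((M_Q Q (\<lambda>x. ereal (\<zeta> x)) i)\<^sup>2) * (osc_Q Q (\<lambda>x. ereal (u x)) i)\<^sup>2)
       \<le> ennreal C *
          (\<Sum>\<^sub>\<infinity>i. (osc_Q Q (\<lambda>x. ereal (\<zeta> x)) i)\<^sup>2 * e2ennreal ((M_Q Q (\<lambda>x. ereal \<bar>u x\<bar>) i)\<^sup>2))"
proof (intro exI[of _ 216] conjI allI impI)
  fix v \<Omega> Q and \<zeta> u :: "complex \<Rightarrow> real"
  assume carpet: "relative_carpet \<Omega> Q" and test: "test_function v \<Omega> Q (\<lambda>x. ereal (\<zeta> x))"
    and nonneg: "\<forall>x\<in>carpet \<Omega> Q. \<zeta> x \<ge> 0" and harmonic: "carpet_harmonic v \<Omega> Q (\<lambda>x. ereal (u x))"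
  let ?R = "\<Sum>\<^sub>\<infinity>i. (osc_Q Q (\<lambda>x. ereal (\<zeta> x)) i)\<^sup>2 * e2ennreal ((M_Q Q (\<lambda>x. ereal \<bar>u x\<bar>) i)\<^sup>2)"
  obtain V where V: "open V" "compactly_in V \<Omega>" "\<forall>x\<in>carpet \<Omega> Q - V. \<zeta> x = 0"
    using test by (auto simp: test_function_def)
  have cutoff: "cutoff v \<Omega> Q V \<zeta> u N" if "0 < N" for N
    using that carpet test nonneg harmonic V
    by unfold_locales (auto simp: test_function_def carpet_harmonic_def)
  show "(\<Sum>\<^sub>\<infinity>i. e2ennreal ((M_Q Q (\<lambda>x. ereal (\<zeta> x)) i)\<^sup>2) * (osc_Q Q (\<lambda>x. ereal (u x)) i)\<^sup>2) \<le> ennreal 216 * ?R"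
  proof (cases "?R < \<infinity>")
    case True
    show ?thesis
    proof (rule infsum_ennreal_leI)
      fix F :: "nat set" assume F: "finite F"
      \<comment> \<open>Chosen after the finite set F: it exceeds the supremum of
        \<open>\<zeta>\<close> on every circle of F, so the truncation is inactive there, while the
        bound does not depend on it.\<close>
      define N where "N = 1 + (\<Sum>i\<in>F. \<bar>SUP x\<in>frontier (Q i). \<zeta> x\<bar>)"
      have "0 < N" by (simp add: N_def add_pos_nonneg sum_nonneg)
      then interpret cutoff v \<Omega> Q V \<zeta> u N by (rule cutoff)
      have R: "?R = rhs"
        using bounds by (simp add: rhs_def M_Q_eq ennreal_power power_mult_distrib ennreal_mult)
      have "(\<Sum>i\<in>F. e2ennreal ((M_Q Q (\<lambda>x. ereal (\<zeta> x)) i)\<^sup>2) * (osc_Q Q (\<lambda>x. ereal (u x)) i)\<^sup>2) =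
          (\<Sum>i\<in>F. ennreal ((min (sup_zeta i) N * osc_u i)\<^sup>2))"
      proof (rule sum.cong[OF refl])
        fix i assume "i \<in> F"
        then have "\<bar>sup_zeta i\<bar> \<le> (\<Sum>i\<in>F. \<bar>SUP x\<in>frontier (Q i). \<zeta> x\<bar>)"
          unfolding sup_zeta_def using F by (intro member_le_sum) auto
        then have "min (sup_zeta i) N = sup_zeta i" by (simp add: N_def)
        then show "e2ennreal ((M_Q Q (\<lambda>x. ereal (\<zeta> x)) i)\<^sup>2) * (osc_Q Q (\<lambda>x. ereal (u x)) i)\<^sup>2 =
            ennreal ((min (sup_zeta i) N * osc_u i)\<^sup>2)"
          using bounds(1) by (simp add: M_Q_eq ennreal_power power_mult_distrib ennreal_mult)
      qed
      also have "\<dots> \<le> (\<Sum>\<^sub>\<infinity>i. ennreal ((min (sup_zeta i) N * osc_u i)\<^sup>2))"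
        using F by (intro sum_le_infsum_ennreal) auto
      also have "\<dots> \<le> ennreal 216 * ?R"
        unfolding R using True R by (intro truncated_inequality harmonic) simp
      finally show "(\<Sum>i\<in>F. e2ennreal ((M_Q Q (\<lambda>x. ereal (\<zeta> x)) i)\<^sup>2) * (osc_Q Q (\<lambda>x. ereal (u x)) i)\<^sup>2) \<le>
          ennreal 216 * ?R" .
    qed
  next
    case False
    then have "?R = top" by (metis infinity_ennreal_def top.not_eq_extremum)
    then have "ennreal 216 * ?R = top" by (simp add: ennreal_mult_top)
    then show ?thesis by simp
  qed
qed simp

end
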